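(* Let $\kappa$ be a nonzero real number, and let $\tilde E_\kappa(2)$, its subalgebra $E_\kappa(2)$, the right ideals $\tilde R_{0+},\tilde R_{0-}\subset\tilde E_\kappa(2)$ and the right ideal $\mathcal R\subset E_\kappa(2)$ defining the four-dimensional bicovariant differential calculus on $E_\kappa(2)$ be as in the context. Then $$\tilde R_{0+}\cap E_\kappa(2)=\tilde R_{0-}\cap E_\kappa(2)=\mathcal R .$$
   Context: $[x,y]=xy-yx$ and $I$ is the unit. $\tilde E_\kappa(2)$ (the deformed double covering of $E(2)$) is the unital complex $*$-algebra generated by $a_0,a_0^*,w_0,w_0^*$ with relations $a_0a_0^*=a_0^*a_0=I$, $[a_0,w_0]=-[a_0,w_0^*]=\frac1{2\kappa}(a_0^2-I)$, $[a_0^*,w_0]=-[a_0^*,w_0^*]=\frac1{2\kappa}((a_0^* )^2-I)$, $[w_0,w_0^*]=-\frac1{2\kappa}(a_0+a_0^* )(w_0+w_0^* )$. $E_\kappa(2)$ is the subalgebra (a Hopf subalgebra) generated by $$A=a_0^2,\qquad A^*=(a_0^* )^2,\qquad v_+=-ia_0w_0,\qquad v_-=iw_0^*a_0^*.$$ These satisfy $AA^*=A^*A=I$, $[A,v_-]=\frac i\kappa(I-A)$, $[A^*,v_-]=\frac i\kappa(A^*-(A^* )^2)$, $[A,v_+]=\frac i\kappa(A-A^2)$, $[A^*,v_+]=\frac i\kappa(I-A^* )$, $[v_+,v_-]=\frac i\kappa(v_--v_+)$; the counit is $\epsilon(A)=\epsilon(A^* )=1$, $\epsilon(v_\pm)=0$.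 $\tilde R_{0+}$ is the right ideal of $\tilde E_\kappa(2)$ (contraction of the ideal of the $4D_+$ calculus on $SU_\mu(2)$) generated by $a_0+a_0^*-2I$, $(a_0-I)w_0$, $(a_0^*-I)w_0$, $(a_0-I)w_0^*$, $(a_0^*-I)w_0^*$, $w_0^2+\frac1\kappa w_0$, $(w_0^* )^2-\frac1\kappa w_0^*$. $\tilde R_{0-}$ is the right ideal of $\tilde E_\kappa(2)$ (contraction of the ideal of the $4D_-$ calculus) generated by $a_0^2+a_0-a_0^*-I$, $(a_0^* )^2+a_0^*-a_0-I$, $(a_0+I)w_0$, $(a_0^*+I)w_0$, $(a_0+I)w_0^*$, $(a_0^*+I)w_0^*$, $w_0^2-\frac1\kappa w_0$, $(w_0^* )^2+\frac1\kappa w_0^*$, $w_0w_0^*-\frac1\kappa w_0-\frac1{\kappa^2}(a_0^*-I)$. $\mathcal R$ is the right ideal of $E_\kappa(2)$, contained in $\ker\epsilon$, which under Woronowicz's correspondence (right ideals of $\ker\epsilon$ versus left-covariant first-order calculi) defines the 4D bicovariant calculus on $E_\kappa(2)$ whose space of left-invariant forms $\ker\epsilon/\mathcal R$ has as basis the classes of $\frac12(A-A^* )$, $v_+$, $v_-$, $v_+v_-+\frac i\kappa v_+$. Explicitly, $\mathcal R$ is the right ideal generated by $A+A^*-2I$, $(A-I)v_+$, $(A-I)v_-$, $v_+^2-\frac i\kappa v_+$, $v_-^2-\frac i\kappa v_-$. *)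

theory Defs
  imports
    Complex_Main
    "HOL-Library.Poly_Mapping"
    "HOL-Algebra.QuotRing"
    "HOL-Algebra.Generated_Rings"
    "HOL-Algebra.Algebraic_Closure_Type"
begin

section \<open>The free unital complex *-algebra on two generators\<close>

text \<open>
  Words form a monoid under concatenation, so that the convolution product on finitely supported
  functions from words to \<open>complex\<close> is the multiplication of the free algebra.
\<close>

instantiation list :: (type) monoid_add
begin

definition zero_list :: "'a list" where "zero_list = []"

definition plus_list :: "'a list \<Rightarrow> 'a list \<Rightarrow> 'a list" where "plus_list = (@)"

instance by standard (auto simp: zero_list_def plus_list_def)

end

datatype letter = LA | LA_star | LW | LW_star

type_synonym free_alg = "letter list \<Rightarrow>\<^sub>0 complex"

definition scalar :: "complex \<Rightarrow> free_alg" where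
  "scalar c = Poly_Mapping.single [] c"

definition letter_elem :: "letter \<Rightarrow> free_alg" where
  "letter_elem x = Poly_Mapping.single [x] 1"

fun letter_star :: "letter \<Rightarrow> letter" where
  "letter_star LA = LA_star"
| "letter_star LA_star = LA"
| "letter_star LW = LW_star"
| "letter_star LW_star = LW"

text \<open>The conjugate-linear anti-automorphism exchanging each generator with its adjoint.\<close>

definition star :: "free_alg \<Rightarrow> free_alg" where
  "star p = (\<Sum>w\<in>Poly_Mapping.keys p.
     Poly_Mapping.single (rev (map letter_star w)) (cnj (Poly_Mapping.lookup p w)))"

definition a0 :: free_alg where "a0 = letter_elem LA"
definition a0s :: free_alg where "a0s = letter_elem LA_star"
definition w0 :: free_alg where "w0 = letter_elem LW"
definition w0s :: free_alg where "w0s = letter_elem LW_star"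

definition commutator :: "free_alg \<Rightarrow> free_alg \<Rightarrow> free_alg" where
  "commutator x y = x * y - y * x"


section \<open>The deformed double covering of E(2)\<close>

definition relators :: "real \<Rightarrow> free_alg set" where
  "relators \<kappa> =
    (let s = scalar (complex_of_real (1 / (2 * \<kappa>))) in
     { a0 * a0s - 1,
       a0s * a0 - 1,
       commutator a0 w0 - s * (a0^2 - 1),
       - commutator a0 w0s - s * (a0^2 - 1),
       commutator a0s w0 - s * (a0s^2 - 1),
       - commutator a0s w0s - s * (a0s^2 - 1),
       commutator w0 w0s + s * (a0 + a0s) * (w0 + w0s) })"

text \<open>
  In a *-algebra the adjoint of every relation holds as well, so the adjoints of the relators are
  included among the generators of the ideal.  An ideal of a unital complex algebra is automatically a complex subspace, hence the
  ring-theoretic notions of ideal and quotient are the right ones.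
\<close>

definition relation_ideal :: "real \<Rightarrow> free_alg set" where
  "relation_ideal \<kappa> =
     Idl\<^bsub>ring_of_type_algebra\<^esub> (relators \<kappa> \<union> star ` relators \<kappa>)"

definition E_tilde :: "real \<Rightarrow> free_alg set ring" where
  "E_tilde \<kappa> = ring_of_type_algebra Quot (relation_ideal \<kappa>)"

definition cls :: "real \<Rightarrow> free_alg \<Rightarrow> free_alg set" where
  "cls \<kappa> x = relation_ideal \<kappa> +>\<^bsub>ring_of_type_algebra\<^esub> x"


section \<open>The subalgebra E(2)\<close>

definition elem_A :: free_alg where "elem_A = a0^2"
definition elem_As :: free_alg where "elem_As = a0s^2"
definition v_plus :: free_alg where "v_plus = scalar (- \<i>) * a0 * w0"
definition v_minus :: free_alg where "v_minus = scalar \<i> * w0s * a0s"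

text \<open>
  A complex subalgebra is a subring containing the scalar multiples of the unit.
\<close>

definition E_kappa :: "real \<Rightarrow> free_alg set ring" where
  "E_kappa \<kappa> = (E_tilde \<kappa>)
     \<lparr> carrier := generate_ring (E_tilde \<kappa>)
         (cls \<kappa> ` (range scalar \<union> {elem_A, elem_As, v_plus, v_minus})) \<rparr>"


section \<open>Right ideals\<close>

definition right_ideal :: "'a set \<Rightarrow> ('a, 'b) ring_scheme \<Rightarrow> bool" where
  "right_ideal J R \<longleftrightarrow>
     additive_subgroup J R \<and> (\<forall>x\<in>J. \<forall>r\<in>carrier R. x \<otimes>\<^bsub>R\<^esub> r \<in> J)"

definition gen_right_ideal :: "('a, 'b) ring_scheme \<Rightarrow> 'a set \<Rightarrow> 'a set" where
  "gen_right_ideal R S = \<Inter> {J. right_ideal J R \<and> S \<subseteq> J}"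

definition R_tilde_plus :: "real \<Rightarrow> free_alg set set" where
  "R_tilde_plus \<kappa> =
    (let h = scalar (complex_of_real (1 / \<kappa>)) in
     gen_right_ideal (E_tilde \<kappa>) (cls \<kappa> `
       { a0 + a0s - 2,
         (a0 - 1) * w0,
         (a0s - 1) * w0,
         (a0 - 1) * w0s,
         (a0s - 1) * w0s,
         w0^2 + h * w0,
         w0s^2 - h * w0s }))"

definition R_tilde_minus :: "real \<Rightarrow> free_alg set set" where
  "R_tilde_minus \<kappa> =
    (let h = scalar (complex_of_real (1 / \<kappa>)) in
     gen_right_ideal (E_tilde \<kappa>) (cls \<kappa> `
       { a0^2 + a0 - a0s - 1,
         a0s^2 + a0s - a0 - 1,
         (a0 + 1) * w0,
         (a0s + 1) * w0,
         (a0 + 1) * w0s,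
         (a0s + 1) * w0s,
         w0^2 - h * w0,
         w0s^2 + h * w0s,
         w0 * w0s - h * w0 - h^2 * (a0s - 1) }))"

definition R_4D :: "real \<Rightarrow> free_alg set set" where
  "R_4D \<kappa> =
    (let ih = scalar (\<i> / complex_of_real \<kappa>) in
     gen_right_ideal (E_kappa \<kappa>) (cls \<kappa> `
       { elem_A + elem_As - 2,
         (elem_A - 1) * v_plus,
         (elem_A - 1) * v_minus,
         v_plus^2 - ih * v_plus,
         v_minus^2 - ih * v_minus }))"


section \<open>Basic facts\<close>

lemma ring_free_alg: "Ring.ring (ring_of_type_algebra :: free_alg ring)"
proof -
  have "\<exists>y. x + y = 0" for x :: free_alg
    using add.right_inverse by blast
  then show ?thesis
    unfolding ring_of_type_algebra_def
    by unfold_locales (auto simp: algebra_simps Units_def)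
qed

lemma relation_ideal_ideal: "ideal (relation_ideal \<kappa>) ring_of_type_algebra"
  unfolding relation_ideal_def
  by (rule ring.genideal_ideal[OF ring_free_alg]) (simp add: ring_of_type_algebra_def)

lemma ring_E_tilde: "Ring.ring (E_tilde \<kappa>)"
  unfolding E_tilde_def by (rule ideal.quotient_is_ring[OF relation_ideal_ideal])

lemma cls_ring_hom: "cls \<kappa> \<in> ring_hom ring_of_type_algebra (E_tilde \<kappa>)"
  unfolding cls_def[abs_def] E_tilde_def
  by (rule ideal.rcos_ring_hom[OF relation_ideal_ideal])

lemma ring_E_kappa: "Ring.ring (E_kappa \<kappa>)"
proof -
  interpret E: Ring.ring "E_tilde \<kappa>" by (rule ring_E_tilde)
  have "cls \<kappa> ` T \<subseteq> carrier (E_tilde \<kappa>)" for T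
    using ring_hom_closed[OF cls_ring_hom] by (auto simp: ring_of_type_algebra_def)
  then show ?thesis
    unfolding E_kappa_def
    by (intro E.subring_is_ring E.generate_ring_is_subring)
qed

lemma star_altdef:
  assumes "finite S" "Poly_Mapping.keys p \<subseteq> S"
  shows "star p = (\<Sum>w\<in>S.
     Poly_Mapping.single (rev (map letter_star w)) (cnj (Poly_Mapping.lookup p w)))"
  unfolding star_def
  by (rule sum.mono_neutral_left) (use assms in \<open>auto simp: in_keys_iff\<close>)

lemma star_add: "star (p + q) = star p + star q"
proof -
  let ?S = "Poly_Mapping.keys p \<union> Poly_Mapping.keys q"
  have "Poly_Mapping.keys (p + q) \<subseteq> ?S"
    by (rule Poly_Mapping.keys_add)
  then show ?thesis
    by (simp add: star_altdef[of ?S] lookup_add single_add sum.distrib)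
qed

lemma star_zero [simp]: "star 0 = 0"
  by (simp add: star_def)

lemma star_sum: "star (sum f T) = (\<Sum>x\<in>T. star (f x))"
  by (induction T rule: infinite_finite_induct) (auto simp: star_add)

lemma star_single:
  "star (Poly_Mapping.single w c) = Poly_Mapping.single (rev (map letter_star w)) (cnj c)"
  by (cases "c = 0") (auto simp: star_def)

lemma letter_star_invol [simp]: "letter_star (letter_star x) = x"
  by (cases x) auto

lemma free_alg_decomp:
  "(p :: free_alg) =
     (\<Sum>w\<in>Poly_Mapping.keys p. Poly_Mapping.single w (Poly_Mapping.lookup p w))"
  by (rule poly_mapping_eqI)
    (auto simp: lookup_sum lookup_single when_def in_keys_iff sum.delta)

lemma star_star [simp]: "star (star p) = p"
proof -
  have "star (star p) =
      (\<Sum>w\<in>Poly_Mapping.keys p. Poly_Mapping.single w (Poly_Mapping.lookup p w))"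
    unfolding star_def[of p] by (simp add: star_sum star_single rev_map comp_def)
  then show ?thesis by (simp add: free_alg_decomp[symmetric])
qed

lemma star_mult: "star (p * q) = star q * star p"
proof -
  have *: "star (Poly_Mapping.single u c * Poly_Mapping.single v d) =
        star (Poly_Mapping.single v d) * star (Poly_Mapping.single u c)" for u v c d
    by (simp add: mult_single star_single plus_list_def mult.commute)
  let ?s = "\<lambda>p w. Poly_Mapping.single w (Poly_Mapping.lookup p w) :: free_alg"
  have "star (p * q) = star ((\<Sum>u\<in>Poly_Mapping.keys p. ?s p u) * (\<Sum>v\<in>Poly_Mapping.keys q. ?s q v))"
    by (simp add: free_alg_decomp[symmetric])
  also have "\<dots> = (\<Sum>u\<in>Poly_Mapping.keys p. \<Sum>v\<in>Poly_Mapping.keys q. star (?s q v) * star (?s p u))"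
    by (simp add: sum_product star_sum *)
  also have "\<dots> = (\<Sum>v\<in>Poly_Mapping.keys q. star (?s q v)) * (\<Sum>u\<in>Poly_Mapping.keys p. star (?s p u))"
    by (simp add: sum_product) (rule sum.swap)
  also have "\<dots> = star (\<Sum>v\<in>Poly_Mapping.keys q. ?s q v) * star (\<Sum>u\<in>Poly_Mapping.keys p. ?s p u)"
    by (simp only: star_sum)
  also have "\<dots> = star q * star p"
    by (simp add: free_alg_decomp[symmetric])
  finally show ?thesis .
qed

lemma star_generators:
  "star a0 = a0s" "star a0s = a0" "star w0 = w0s" "star w0s = w0"
  by (simp_all add: a0_def a0s_def w0_def w0s_def letter_elem_def star_single)

lemma star_scalar: "star (scalar c) = scalar (cnj c)"
  by (simp add: scalar_def star_single)

lemma scalar_comm: "scalar c * p = p * scalar c"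
proof -
  have "scalar c * Poly_Mapping.single w d = Poly_Mapping.single w d * scalar c" for w d
    by (simp add: scalar_def mult_single plus_list_def mult.commute)
  then show ?thesis
    by (subst (1 2) free_alg_decomp[of p]) (simp add: sum_distrib_left sum_distrib_right)
qed

lemma star_elem_A: "star elem_A = elem_As"
  by (simp add: elem_A_def elem_As_def power2_eq_square star_mult star_generators)

lemma star_v_plus: "star v_plus = v_minus"
  by (simp add: v_plus_def v_minus_def star_mult star_generators star_scalar scalar_comm
      mult.assoc)

text \<open>
  The relation ideal is invariant under the star, so the star descends to the quotient, which is
  thereby a *-algebra.
\<close>

lemma star_relation_ideal: "x \<in> relation_ideal \<kappa> \<Longrightarrow> star x \<in> relation_ideal \<kappa>"
proof -
  let ?F = "ring_of_type_algebra :: free_alg ring"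
  let ?I = "relation_ideal \<kappa>"
  interpret F: Ring.ring ?F by (rule ring_free_alg)
  interpret I: ideal ?I ?F by (rule relation_ideal_ideal)
  have sm: "star (- p) = - star p" for p
    using star_add[of p "- p"] by (simp add: eq_neg_iff_add_eq_0 add.commute)
  have inv: "- a \<in> ?I" if "a \<in> ?I" for a
  proof -
    have "(- 1) \<otimes>\<^bsub>?F\<^esub> a \<in> ?I"
      using that by (intro I.I_l_closed) (simp_all add: ring_of_type_algebra_def)
    then show ?thesis by (simp add: ring_of_type_algebra_def)
  qed
  have "ideal (star -` ?I) ?F"
  proof (rule idealI)
    show "Ring.ring ?F" by (rule ring_free_alg)
    show "subgroup (star -` ?I) (add_monoid ?F)"
    proof (rule group.subgroupI)
      show "Group.group (add_monoid ?F)"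
        by (rule F.add.is_group)
      have "star 0 \<in> ?I"
        using I.zero_closed by (simp add: ring_of_type_algebra_def)
      then show "star -` ?I \<noteq> {}"
        by blast
    next
      fix p assume p: "p \<in> star -` ?I"
      have "inv\<^bsub>add_monoid ?F\<^esub> p = - p"
        unfolding a_inv_def[symmetric]
        by (rule F.minus_equality) (simp_all add: ring_of_type_algebra_def)
      then show "inv\<^bsub>add_monoid ?F\<^esub> p \<in> star -` ?I"
        using p inv by (simp add: sm)
    next
      fix p q assume "p \<in> star -` ?I" "q \<in> star -` ?I"
      then show "p \<otimes>\<^bsub>add_monoid ?F\<^esub> q \<in> star -` ?I"
        using I.a_closed[of "star p" "star q"] by (simp add: ring_of_type_algebra_def star_add)
    qed (auto simp: ring_of_type_algebra_def)
  next
    fix p q assume "p \<in> star -` ?I" "q \<in> carrier ?F"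
    then show "q \<otimes>\<^bsub>?F\<^esub> p \<in> star -` ?I" "p \<otimes>\<^bsub>?F\<^esub> q \<in> star -` ?I"
      using I.I_r_closed[of "star p" "star q"] I.I_l_closed[of "star p" "star q"]
      by (simp_all add: ring_of_type_algebra_def star_mult)
  qed
  moreover have "relators \<kappa> \<union> star ` relators \<kappa> \<subseteq> ?I"
    unfolding relation_ideal_def
    by (rule F.genideal_self) (simp add: ring_of_type_algebra_def)
  then have "relators \<kappa> \<union> star ` relators \<kappa> \<subseteq> star -` ?I"
    by auto
  ultimately have "?I \<subseteq> star -` ?I"
    unfolding relation_ideal_def by (rule F.genideal_minimal)
  then show "x \<in> ?I \<Longrightarrow> star x \<in> ?I"
    by blast
qed

end

theory Submission
  imports Defs "HOL-Library.Product_Plus"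
begin

text \<open>
  Write \<open>R\<close> for the right ideal of the calculus and \<open>J\<close> for one of the two right ideals of the covering.
  The argument compares dimensions.  In the quotient of the subalgebra by \<open>R\<close> the five classes of
  \<open>1\<close>, \<open>A\<close>, \<open>v_plus\<close>, \<open>v_minus\<close>, \<open>v_plus v_minus\<close> span, because their span contains the class of the unit
  and is stable under right multiplication by the generators (\<open>E_kappa_normal_form\<close>).  Moreover \<open>R\<close> is
  contained in \<open>J\<close>, because its generators are explicit right combinations of those of \<open>J\<close>
  (\<open>generators_from_plus\<close>, \<open>generators_from_minus\<close>).  Hence \<open>R\<close> is the intersection of \<open>J\<close> with the
  subalgebra as soon as those five elements remain linearly independent modulo \<open>J\<close>
  (\<open>inter_subset_R_4D\<close>).

  For the independence, a five-dimensional right module over the covering with a vector \<open>e\<close> annihilated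
  by \<open>J\<close> is written down by matrices; it is in fact the quotient by \<open>J\<close>, but only the annihilation
  (\<open>plus_act_R_tilde_plus\<close>, \<open>minus_act_R_tilde_minus\<close>) is needed.  The five elements send \<open>e\<close> to a
  linearly independent family.  No basis of the covering itself is used.
\<close>

section \<open>Congruence modulo the relation ideal\<close>

lemma relation_ideal_zero: "0 \<in> relation_ideal \<kappa>"
  using additive_subgroup.zero_closed[OF ideal.axioms(1)[OF relation_ideal_ideal[of \<kappa>]]]
  by (simp add: ring_of_type_algebra_def)

lemma relation_ideal_add:
  "x \<in> relation_ideal \<kappa> \<Longrightarrow> y \<in> relation_ideal \<kappa> \<Longrightarrow> x + y \<in> relation_ideal \<kappa>"
  using additive_subgroup.a_closed[OF ideal.axioms(1)[OF relation_ideal_ideal[of \<kappa>]], of x y]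
  by (simp add: ring_of_type_algebra_def)

lemma relation_ideal_mult:
  assumes "x \<in> relation_ideal \<kappa>"
  shows "y * x \<in> relation_ideal \<kappa>" and "x * y \<in> relation_ideal \<kappa>"
proof -
  interpret I: ideal "relation_ideal \<kappa>" ring_of_type_algebra by (rule relation_ideal_ideal)
  show "y * x \<in> relation_ideal \<kappa>" "x * y \<in> relation_ideal \<kappa>"
    using I.I_l_closed[of x y] I.I_r_closed[of x y] assms by (simp_all add: ring_of_type_algebra_def)
qed

lemma relation_ideal_uminus: "x \<in> relation_ideal \<kappa> \<Longrightarrow> - x \<in> relation_ideal \<kappa>"
  using relation_ideal_mult(1)[of x \<kappa> "- 1"] by simp

lemma relation_ideal_diff:
  "x \<in> relation_ideal \<kappa> \<Longrightarrow> y \<in> relation_ideal \<kappa> \<Longrightarrow> x - y \<in> relation_ideal \<kappa>"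
  using relation_ideal_add[of x \<kappa> "- y"] by (simp add: relation_ideal_uminus)

lemma relators_subset: "relators \<kappa> \<subseteq> relation_ideal \<kappa>"
  using ring.genideal_self[OF ring_free_alg, of "relators \<kappa> \<union> star ` relators \<kappa>"]
  by (simp add: relation_ideal_def ring_of_type_algebra_def)

lemma cls_altdef: "cls \<kappa> x = {z. z - x \<in> relation_ideal \<kappa>}"
  unfolding cls_def a_r_coset_def'
  by (auto simp: ring_of_type_algebra_def algebra_simps intro!: bexI[of _ "_ - x"])

lemma cls_eq_iff: "cls \<kappa> x = cls \<kappa> y \<longleftrightarrow> x - y \<in> relation_ideal \<kappa>"
proof
  assume "cls \<kappa> x = cls \<kappa> y"
  moreover have "x \<in> cls \<kappa> x"
    by (simp add: cls_altdef relation_ideal_zero)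
  ultimately show "x - y \<in> relation_ideal \<kappa>"
    by (simp add: cls_altdef)
next
  assume d: "x - y \<in> relation_ideal \<kappa>"
  have "z - x \<in> relation_ideal \<kappa> \<longleftrightarrow> z - y \<in> relation_ideal \<kappa>" for z
    using relation_ideal_add[OF _ d, of "z - x"] relation_ideal_diff[OF _ d, of "z - y"] by auto
  then show "cls \<kappa> x = cls \<kappa> y"
    by (simp add: cls_altdef)
qed

lemma cls_surj: "Y \<in> carrier (E_tilde \<kappa>) \<Longrightarrow> \<exists>x. Y = cls \<kappa> x"
  unfolding E_tilde_def FactRing_def cls_def by (auto simp: A_RCOSETS_defs a_r_coset_defs)

lemma cls_closed: "cls \<kappa> x \<in> carrier (E_tilde \<kappa>)"
  using ring_hom_closed[OF cls_ring_hom] by (simp add: ring_of_type_algebra_def)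

lemma cls_add: "cls \<kappa> (x + y) = cls \<kappa> x \<oplus>\<^bsub>E_tilde \<kappa>\<^esub> cls \<kappa> y"
  and cls_mult: "cls \<kappa> (x * y) = cls \<kappa> x \<otimes>\<^bsub>E_tilde \<kappa>\<^esub> cls \<kappa> y"
  and cls_one: "cls \<kappa> 1 = \<one>\<^bsub>E_tilde \<kappa>\<^esub>"
  using ring_hom_add[OF cls_ring_hom, of x y] ring_hom_mult[OF cls_ring_hom, of x y]
    ring_hom_one[OF cls_ring_hom] by (simp_all add: ring_of_type_algebra_def)

lemma cls_zero: "cls \<kappa> 0 = \<zero>\<^bsub>E_tilde \<kappa>\<^esub>"
proof -
  interpret Ring.ring "E_tilde \<kappa>" by (rule ring_E_tilde)
  show ?thesis
    using cls_add[of \<kappa> 0 0] cls_closed[of \<kappa> 0] by simp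
qed

lemma cls_uminus: "cls \<kappa> (- x) = \<ominus>\<^bsub>E_tilde \<kappa>\<^esub> cls \<kappa> x"
proof -
  interpret Ring.ring "E_tilde \<kappa>" by (rule ring_E_tilde)
  show ?thesis
    using cls_add[of \<kappa> "- x" x] cls_closed by (simp add: cls_zero minus_equality)
qed

section \<open>Right modules over the free algebra\<close>

text \<open>
  By the universal property of the free algebra, four endomorphisms of a complex vector space, one
  for each letter, make it a right module.  A word acts by its letters from left to right, which is
  why \<^const>\<open>fold\<close> appears.
\<close>

locale free_alg_right_module = vector_space scale
  for scale :: "complex \<Rightarrow> 'v::ab_group_add \<Rightarrow> 'v" +
  fixes T :: "letter \<Rightarrow> 'v \<Rightarrow> 'v"
  assumes T_add: "T x (u + v) = T x u + T x v"
    and T_scale: "T x (scale c v) = scale c (T x v)"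
begin

definition act :: "'v \<Rightarrow> free_alg \<Rightarrow> 'v" where
  "act v p = (\<Sum>w\<in>Poly_Mapping.keys p. scale (Poly_Mapping.lookup p w) (fold T w v))"

lemma act_altdef:
  assumes "finite S" "Poly_Mapping.keys p \<subseteq> S"
  shows "act v p = (\<Sum>w\<in>S. scale (Poly_Mapping.lookup p w) (fold T w v))"
  unfolding act_def
  by (rule sum.mono_neutral_left) (use assms in \<open>auto simp: in_keys_iff\<close>)

lemma act_zero [simp]: "act v 0 = 0"
  by (simp add: act_def)

lemma act_single: "act v (Poly_Mapping.single w c) = scale c (fold T w v)"
  by (cases "c = 0") (auto simp: act_def)

lemma act_add: "act v (p + q) = act v p + act v q"
proof -
  let ?S = "Poly_Mapping.keys p \<union> Poly_Mapping.keys q"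
  have "Poly_Mapping.keys (p + q) \<subseteq> ?S"
    by (rule Poly_Mapping.keys_add)
  then show ?thesis
    by (simp add: act_altdef[of ?S] lookup_add scale_left_distrib sum.distrib)
qed

lemma act_uminus: "act v (- p) = - act v p"
  using act_add[of v "- p" p] by (simp add: eq_neg_iff_add_eq_0)

lemma act_diff: "act v (p - q) = act v p - act v q"
  using act_add[of v p "- q"] by (simp add: act_uminus)

lemma act_sum: "act v (sum f S) = (\<Sum>x\<in>S. act v (f x))"
  by (induction S rule: infinite_finite_induct) (auto simp: act_add)

lemma fold_T_add: "fold T w (u + v) = fold T w u + fold T w v"
  by (induction w arbitrary: u v) (simp_all add: T_add)

lemma fold_T_scale: "fold T w (scale c v) = scale c (fold T w v)"
  by (induction w arbitrary: v) (simp_all add: T_scale)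

lemma act_add_left: "act (u + v) p = act u p + act v p"
  by (simp add: act_def fold_T_add scale_right_distrib sum.distrib)

lemma act_zero_left [simp]: "act 0 p = 0"
  using act_add_left[of 0 0 p] by simp

lemma act_sum_left: "act (sum f S) p = (\<Sum>x\<in>S. act (f x) p)"
  by (induction S rule: infinite_finite_induct) (auto simp: act_add_left)

lemma act_mult: "act v (p * q) = act (act v p) q"
proof -
  let ?s = "\<lambda>p w. Poly_Mapping.single w (Poly_Mapping.lookup p w) :: free_alg"
  have *: "act v (?s p w * ?s q w') = act (act v (?s p w)) (?s q w')" for w w'
    by (simp add: mult_single plus_list_def act_single fold_T_scale mult.commute)
  have "act v (p * q) =
      act v ((\<Sum>w\<in>Poly_Mapping.keys p. ?s p w) * (\<Sum>w\<in>Poly_Mapping.keys q. ?s q w))"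
    by (simp add: free_alg_decomp[symmetric])
  also have "\<dots> =
      (\<Sum>w\<in>Poly_Mapping.keys p. act (act v (?s p w)) (\<Sum>w\<in>Poly_Mapping.keys q. ?s q w))"
    by (simp only: sum_product act_sum *)
  also have "\<dots> = act (act v p) q"
    by (simp add: free_alg_decomp[symmetric] act_sum[symmetric] act_sum_left[symmetric])
  finally show ?thesis .
qed

lemma act_scalar: "act v (scalar c) = scale c v"
  by (simp add: scalar_def act_single)

lemma act_one: "act v 1 = v"
  using act_single[of v "[]" 1] by (simp add: single_one[symmetric] zero_list_def)

lemma act_two: "act v 2 = v + v"
  by (simp only: one_add_one[symmetric] act_add act_one)

lemma act_generators:
  "act v a0 = T LA v" "act v a0s = T LA_star v" "act v w0 = T LW v" "act v w0s = T LW_star v"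
  by (simp_all add: a0_def a0s_def w0_def w0s_def letter_elem_def act_single)

lemmas act_simps = act_add act_uminus act_diff act_mult act_scalar act_one act_two act_generators

text \<open>
  The elements acting as zero form a two-sided ideal, so only the relators and their adjoints have
  to be tested for the module to descend to the quotient.
\<close>

lemma act_relation_ideal:
  assumes "\<And>x v. x \<in> relators \<kappa> \<Longrightarrow> act v x = 0"
    and "\<And>x v. x \<in> relators \<kappa> \<Longrightarrow> act v (star x) = 0"
    and "x \<in> relation_ideal \<kappa>"
  shows "act v x = 0"
proof -
  let ?F = "ring_of_type_algebra :: free_alg ring"
  let ?N = "{x. \<forall>v. act v x = 0}"
  interpret F: Ring.ring ?F by (rule ring_free_alg)
  have "ideal ?N ?F"
  proof (rule idealI)
    show "Ring.ring ?F" by (rule ring_free_alg)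
    show "subgroup ?N (add_monoid ?F)"
    proof (rule group.subgroupI)
      show "Group.group (add_monoid ?F)"
        by (rule F.add.is_group)
      show "?N \<noteq> {}"
        using act_zero by blast
    next
      fix p assume p: "p \<in> ?N"
      have "inv\<^bsub>add_monoid ?F\<^esub> p = - p"
        unfolding a_inv_def[symmetric]
        by (rule F.minus_equality) (simp_all add: ring_of_type_algebra_def)
      then show "inv\<^bsub>add_monoid ?F\<^esub> p \<in> ?N"
        using p by (simp add: act_uminus)
    qed (auto simp: ring_of_type_algebra_def act_add)
  qed (auto simp: ring_of_type_algebra_def act_mult)
  moreover have "relators \<kappa> \<union> star ` relators \<kappa> \<subseteq> ?N"
    using assms by auto
  ultimately have "relation_ideal \<kappa> \<subseteq> ?N"
    unfolding relation_ideal_def by (rule F.genideal_minimal)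
  then show ?thesis using assms(3) by blast
qed

end

section \<open>Two five-dimensional modules over the deformed covering\<close>

type_synonym vec5 = "complex \<times> complex \<times> complex \<times> complex \<times> complex"

text \<open>Row vectors; letters act on them from the right.\<close>

definition scale5 :: "complex \<Rightarrow> vec5 \<Rightarrow> vec5" where
  "scale5 c = (\<lambda>(x0, x1, x2, x3, x4). (c * x0, c * x1, c * x2, c * x3, c * x4))"

lemma scale5_simp [simp]: "scale5 c (x0, x1, x2, x3, x4) = (c * x0, c * x1, c * x2, c * x3, c * x4)"
  by (simp add: scale5_def)

text \<open>
  The right module \<open>E_tilde / R_tilde_plus\<close> with \<open>h = 1 / (2\<kappa>)\<close>, in the basis \<open>e\<close>, \<open>f = e (a0 - 1)\<close>,
  \<open>p = e w0\<close>, \<open>q = e w0s\<close>, \<open>r = e w0 w0s\<close>, where \<open>e\<close> is the class of the unit.  The argument is the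
  tuple of coordinates of a vector.  For instance \<open>e a0 = e + f\<close>, \<open>p a0 = p - 2h f\<close> and
  \<open>q w0 = r + 2h (p + q)\<close>.
\<close>

fun T_plus :: "complex \<Rightarrow> letter \<Rightarrow> vec5 \<Rightarrow> vec5" where
  "T_plus h LA (e, f, p, q, r) = (e, e + f - 2 * h * p + 2 * h * q - 4 * h^2 * r, p, q, r)"
| "T_plus h LA_star (e, f, p, q, r) = (e, - e + f + 2 * h * p - 2 * h * q + 4 * h^2 * r, p, q, r)"
| "T_plus h LW (e, f, p, q, r) = (0, 0, e - 2 * h * p + 2 * h * q - 4 * h^2 * r, 2 * h * q, q)"
| "T_plus h LW_star (e, f, p, q, r) = (0, 0, 0, e + 2 * h * q - 8 * h^2 * r, p - 2 * h * r)"

text \<open>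
  The right module \<open>E_tilde / R_tilde_minus\<close>, in the basis \<open>e\<close>, \<open>g = e (a0 + 1)\<close>, \<open>k = g (a0 - 1)\<close>,
  \<open>p = e w0\<close>, \<open>q = e w0s\<close>.  Here \<open>e w0 w0s\<close> is not a new basis vector: the last generator of the ideal
  makes it \<open>2h p + 4h\<^sup>2 (k + g - 2e)\<close>.
\<close>

fun T_minus :: "complex \<Rightarrow> letter \<Rightarrow> vec5 \<Rightarrow> vec5" where
  "T_minus h LA (e, g, k, p, q) = (- e, e + g, g - k - h * p + h * q, - p, - q)"
| "T_minus h LA_star (e, g, k, p, q) = (- e, e + g, e + g - k + h * p - h * q, - p, - q)"
| "T_minus h LW (e, g, k, p, q) =
    (- 8 * h^2 * q, 4 * h^2 * q, 4 * h^2 * q, e + 2 * h * p, - 2 * h * q)"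
| "T_minus h LW_star (e, g, k, p, q) =
    (- 8 * h^2 * p, 4 * h^2 * p, 4 * h^2 * p, 2 * h * p, e - 2 * h * q)"

lemma vector_space_scale5: "vector_space scale5"
  by unfold_locales (auto simp: scale5_def algebra_simps)

interpretation plus: free_alg_right_module scale5 "T_plus h" for h
proof (intro free_alg_right_module.intro vector_space_scale5 free_alg_right_module_axioms.intro)
  fix x and u v :: vec5 and c
  show "T_plus h x (u + v) = T_plus h x u + T_plus h x v"
    by (cases x; cases u; cases v) (simp_all add: algebra_simps)
  show "T_plus h x (scale5 c v) = scale5 c (T_plus h x v)"
    by (cases x; cases v) (simp_all add: algebra_simps)
qed

interpretation minus: free_alg_right_module scale5 "T_minus h" for h
proof (intro free_alg_right_module.intro vector_space_scale5 free_alg_right_module_axioms.intro)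
  fix x and u v :: vec5 and c
  show "T_minus h x (u + v) = T_minus h x u + T_minus h x v"
    by (cases x; cases u; cases v) (simp_all add: algebra_simps)
  show "T_minus h x (scale5 c v) = scale5 c (T_minus h x v)"
    by (cases x; cases v) (simp_all add: algebra_simps)
qed

lemma star_uminus: "star (- p) = - star p"
  using star_add[of "- p" p] by (simp add: eq_neg_iff_add_eq_0)

lemma star_diff: "star (p - q) = star p - star q"
  using star_add[of p "- q"] by (simp add: star_uminus)

lemma star_one: "star 1 = 1"
  using star_scalar[of 1] by (simp add: scalar_def single_one[symmetric] zero_list_def)

lemmas star_simps = star_add star_diff star_uminus star_mult star_one star_generators star_scalar

text \<open>The relations of the deformed covering hold in both modules.\<close>

lemma plus_act_relation_ideal:
  assumes "x \<in> relation_ideal \<kappa>"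
  shows "plus.act (complex_of_real (1 / (2 * \<kappa>))) v x = 0"
proof (rule plus.act_relation_ideal[OF _ _ assms])
  fix x and v :: vec5
  define h where "h = complex_of_real (1 / (2 * \<kappa>))"
  have cnj_h: "cnj h = h" by (simp add: h_def)
  assume x: "x \<in> relators \<kappa>"
  show "plus.act (complex_of_real (1 / (2 * \<kappa>))) v x = 0"
    using x unfolding relators_def Let_def commutator_def h_def[symmetric]
    by (elim insertE emptyE; hypsubst; cases v;
        simp add: plus.act_simps power2_eq_square zero_prod_def; simp add: algebra_simps)
  show "plus.act (complex_of_real (1 / (2 * \<kappa>))) v (star x) = 0"
    using x unfolding relators_def Let_def commutator_def h_def[symmetric]
    by (elim insertE emptyE; hypsubst; cases v;
        simp add: star_simps cnj_h plus.act_simps power2_eq_square zero_prod_def;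
        simp add: algebra_simps)
qed

lemma minus_act_relation_ideal:
  assumes "x \<in> relation_ideal \<kappa>"
  shows "minus.act (complex_of_real (1 / (2 * \<kappa>))) v x = 0"
proof (rule minus.act_relation_ideal[OF _ _ assms])
  fix x and v :: vec5
  define h where "h = complex_of_real (1 / (2 * \<kappa>))"
  have cnj_h: "cnj h = h" by (simp add: h_def)
  assume x: "x \<in> relators \<kappa>"
  show "minus.act (complex_of_real (1 / (2 * \<kappa>))) v x = 0"
    using x unfolding relators_def Let_def commutator_def h_def[symmetric]
    by (elim insertE emptyE; hypsubst; cases v;
        simp add: minus.act_simps power2_eq_square zero_prod_def; simp add: algebra_simps)
  show "minus.act (complex_of_real (1 / (2 * \<kappa>))) v (star x) = 0"
    using x unfolding relators_def Let_def commutator_def h_def[symmetric]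
    by (elim insertE emptyE; hypsubst; cases v;
        simp add: star_simps cnj_h minus.act_simps power2_eq_square zero_prod_def;
        simp add: algebra_simps)
qed

lemma one_notin_relation_ideal: "1 \<notin> relation_ideal \<kappa>"
  using plus_act_relation_ideal[of 1 \<kappa> "(1, 0, 0, 0, 0)"]
  by (auto simp: plus.act_one zero_prod_def)

section \<open>The ring of families of elements of the deformed coverings\<close>

lemma relation_ideal_cong_diff:
  assumes "x - x' \<in> relation_ideal \<kappa>" "y - y' \<in> relation_ideal \<kappa>"
  shows "(x - y) - (x' - y') \<in> relation_ideal \<kappa>"
  using relation_ideal_diff[OF assms] by (simp add: algebra_simps)

lemma relation_ideal_cong_add:
  assumes "x - x' \<in> relation_ideal \<kappa>" "y - y' \<in> relation_ideal \<kappa>"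
  shows "(x + y) - (x' + y') \<in> relation_ideal \<kappa>"
  using relation_ideal_add[OF assms] by (simp add: algebra_simps)

lemma relation_ideal_cong_mult:
  assumes "x - x' \<in> relation_ideal \<kappa>" "y - y' \<in> relation_ideal \<kappa>"
  shows "x * y - x' * y' \<in> relation_ideal \<kappa>"
  using relation_ideal_add[OF relation_ideal_mult(2)[OF assms(1), of y]
      relation_ideal_mult(1)[OF assms(2), of x']]
  by (simp add: algebra_simps)

text \<open>
  The product of the quotient algebras over all parameters \<open>\<kappa>\<close>.  A single quotient algebra depends on
  the value \<open>\<kappa>\<close> and so cannot be a type, whereas the product can; the defining relations hold in it
  with the families \<open>\<kappa> \<mapsto> a0\<close>, \<open>\<kappa> \<mapsto> 1 / (2\<kappa>)\<close> etc. in place of the generators and coefficients.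
  Computations in the noncommutative ring \<open>covering_family\<close> can therefore be done by rewriting, and
  evaluation at \<open>\<kappa>\<close> transports the results to each quotient.
\<close>

(* Free algebra elements are atomic here, not functions from words to coefficients. *)
lifting_forget poly_mapping.lifting

quotient_type covering_family = "real \<Rightarrow> free_alg" /
  "\<lambda>f g. \<forall>\<kappa>. f \<kappa> - g \<kappa> \<in> relation_ideal \<kappa>"
proof (rule equivpI)
  show "reflp (\<lambda>f g. \<forall>\<kappa>. f \<kappa> - g \<kappa> \<in> relation_ideal \<kappa>)"
    by (simp add: reflp_def relation_ideal_zero)
  show "symp (\<lambda>f g. \<forall>\<kappa>. f \<kappa> - g \<kappa> \<in> relation_ideal \<kappa>)"
    using relation_ideal_uminus by (fastforce intro: sympI)
  show "transp (\<lambda>f g. \<forall>\<kappa>. f \<kappa> - g \<kappa> \<in> relation_ideal \<kappa>)"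
    using relation_ideal_add by (fastforce intro: transpI)
qed

instantiation covering_family :: ring_1
begin

lift_definition zero_covering_family :: covering_family is "\<lambda>_. 0" .

lift_definition one_covering_family :: covering_family is "\<lambda>_. 1" .

lift_definition plus_covering_family ::
  "covering_family \<Rightarrow> covering_family \<Rightarrow> covering_family" is "\<lambda>f g \<kappa>. f \<kappa> + g \<kappa>"
  by (simp add: relation_ideal_cong_add)

lift_definition uminus_covering_family :: "covering_family \<Rightarrow> covering_family" is
  "\<lambda>f \<kappa>. - f \<kappa>"
  using relation_ideal_uminus by fastforce

lift_definition minus_covering_family ::
  "covering_family \<Rightarrow> covering_family \<Rightarrow> covering_family" is "\<lambda>f g \<kappa>. f \<kappa> - g \<kappa>"
  by (simp add: relation_ideal_cong_diff)

lift_definition times_covering_family ::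
  "covering_family \<Rightarrow> covering_family \<Rightarrow> covering_family" is "\<lambda>f g \<kappa>. f \<kappa> * g \<kappa>"
  by (simp add: relation_ideal_cong_mult)

instance
proof
  have "- 1 \<notin> relation_ideal \<kappa>" for \<kappa>
    using relation_ideal_uminus[of "- 1" \<kappa>] one_notin_relation_ideal by auto
  then show "(0 :: covering_family) \<noteq> 1"
    by transfer simp
qed (transfer; simp add: algebra_simps relation_ideal_zero)+

end

text \<open>The class of a family, and its component at a given parameter.\<close>

lift_definition family :: "(real \<Rightarrow> free_alg) \<Rightarrow> covering_family" is "\<lambda>f. f" .

lift_definition value_at :: "real \<Rightarrow> covering_family \<Rightarrow> free_alg set" is "\<lambda>\<kappa> f. cls \<kappa> (f \<kappa>)"
  by (simp add: cls_eq_iff)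

lemma value_at_family [simp]: "value_at \<kappa> (family f) = cls \<kappa> (f \<kappa>)"
  by transfer simp

lemma value_at_closed: "value_at \<kappa> x \<in> carrier (E_tilde \<kappa>)"
  by transfer (rule cls_closed)

lemma value_at_add: "value_at \<kappa> (x + y) = value_at \<kappa> x \<oplus>\<^bsub>E_tilde \<kappa>\<^esub> value_at \<kappa> y"
  by transfer (rule cls_add)

lemma value_at_mult: "value_at \<kappa> (x * y) = value_at \<kappa> x \<otimes>\<^bsub>E_tilde \<kappa>\<^esub> value_at \<kappa> y"
  by transfer (rule cls_mult)

lemma value_at_one: "value_at \<kappa> 1 = \<one>\<^bsub>E_tilde \<kappa>\<^esub>"
  by transfer (rule cls_one)

lemma value_at_zero: "value_at \<kappa> 0 = \<zero>\<^bsub>E_tilde \<kappa>\<^esub>"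
  by transfer (rule cls_zero)

lemma value_at_uminus: "value_at \<kappa> (- x) = \<ominus>\<^bsub>E_tilde \<kappa>\<^esub> value_at \<kappa> x"
  by transfer (rule cls_uminus)

lemma family_add: "family (\<lambda>\<kappa>. f \<kappa> + g \<kappa>) = family f + family g"
  and family_diff: "family (\<lambda>\<kappa>. f \<kappa> - g \<kappa>) = family f - family g"
  and family_uminus: "family (\<lambda>\<kappa>. - f \<kappa>) = - family f"
  and family_mult: "family (\<lambda>\<kappa>. f \<kappa> * g \<kappa>) = family f * family g"
  and family_zero: "family (\<lambda>\<kappa>. 0) = 0"
  and family_one: "family (\<lambda>\<kappa>. 1) = 1"
  by (transfer; simp add: relation_ideal_zero)+

lemma family_two: "family (\<lambda>\<kappa>. 2) = 2"
  by (simp only: one_add_one[symmetric] family_add family_one)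

lemma family_power2: "family (\<lambda>\<kappa>. (f \<kappa>)^2) = (family f)^2"
  by (simp add: power2_eq_square family_mult)

text \<open>
  The constant families of generators, the central families of scalars, and the coefficient
  \<open>1 / (2\<kappa>)\<close> of the relations.
\<close>

definition fa where "fa = family (\<lambda>_. a0)"
definition fas where "fas = family (\<lambda>_. a0s)"
definition fw where "fw = family (\<lambda>_. w0)"
definition fws where "fws = family (\<lambda>_. w0s)"
definition fscal :: "(real \<Rightarrow> complex) \<Rightarrow> covering_family" where
  "fscal f = family (\<lambda>\<kappa>. scalar (f \<kappa>))"
definition fh where "fh = fscal (\<lambda>\<kappa>. complex_of_real (1 / (2 * \<kappa>)))"

lemmas family_simps = family_add family_diff family_uminus family_mult family_one family_two
  family_power2 fa_def[symmetric] fas_def[symmetric] fw_def[symmetric] fws_def[symmetric]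
  fscal_def[symmetric]

lemma fscal_comm: "x * fscal f = fscal f * x"
  unfolding fscal_def by transfer (simp add: scalar_comm relation_ideal_zero)

lemma family_eqI: "(\<And>\<kappa>. f \<kappa> - g \<kappa> \<in> relation_ideal \<kappa>) \<Longrightarrow> family f = family g"
  by transfer simp

lemma scalar_add: "scalar (c + d) = scalar c + scalar d"
  by (simp add: scalar_def single_add)

lemma scalar_mult: "scalar (c * d) = scalar c * scalar d"
  by (simp add: scalar_def mult_single plus_list_def)

lemma scalar_one: "scalar 1 = 1"
  by (simp add: scalar_def single_one[symmetric] zero_list_def)

lemma scalar_uminus: "scalar (- c) = - scalar c"
  by (simp add: scalar_def single_uminus)

lemma fscal_add: "fscal (\<lambda>\<kappa>. f \<kappa> + g \<kappa>) = fscal f + fscal g"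
  and fscal_mult: "fscal (\<lambda>\<kappa>. f \<kappa> * g \<kappa>) = fscal f * fscal g"
  and fscal_one: "fscal (\<lambda>\<kappa>. 1) = 1"
  and fscal_uminus: "fscal (\<lambda>\<kappa>. - f \<kappa>) = - fscal f"
  by (simp_all add: fscal_def scalar_add scalar_mult scalar_one scalar_uminus
      family_add family_mult family_one family_uminus)

lemma relators_family:
  "fa * fas = 1" "fas * fa = 1"
  "fa * fw - fw * fa = fh * (fa^2 - 1)"
  "- (fa * fws - fws * fa) = fh * (fa^2 - 1)"
  "fas * fw - fw * fas = fh * (fas^2 - 1)"
  "- (fas * fws - fws * fas) = fh * (fas^2 - 1)"
  "fw * fws - fws * fw = - (fh * (fa + fas) * (fw + fws))"
proof -
  let ?s = "\<lambda>\<kappa>. scalar (complex_of_real (1 / (2 * \<kappa>)))"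
  have sub: "f \<kappa> - g \<kappa> \<in> relators \<kappa> \<Longrightarrow> f \<kappa> - g \<kappa> \<in> relation_ideal \<kappa>"
    for \<kappa> and f g :: "real \<Rightarrow> free_alg"
    using relators_subset by auto
  have "family (\<lambda>_. a0 * a0s) = family (\<lambda>_. 1)"
    by (rule family_eqI, rule sub) (simp add: relators_def Let_def)
  then show "fa * fas = 1" by (simp add: family_simps)
  have "family (\<lambda>_. a0s * a0) = family (\<lambda>_. 1)"
    by (rule family_eqI, rule sub) (simp add: relators_def Let_def)
  then show "fas * fa = 1" by (simp add: family_simps)
  have "family (\<lambda>_. commutator a0 w0) = family (\<lambda>\<kappa>. ?s \<kappa> * (a0^2 - 1))"
    by (rule family_eqI, rule sub) (simp add: relators_def Let_def)
  then show "fa * fw - fw * fa = fh * (fa^2 - 1)"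
    by (simp add: commutator_def family_simps fh_def)
  have "family (\<lambda>_. - commutator a0 w0s) = family (\<lambda>\<kappa>. ?s \<kappa> * (a0^2 - 1))"
    by (rule family_eqI, rule sub) (simp add: relators_def Let_def)
  then show "- (fa * fws - fws * fa) = fh * (fa^2 - 1)"
    unfolding commutator_def family_simps fh_def .
  have "family (\<lambda>_. commutator a0s w0) = family (\<lambda>\<kappa>. ?s \<kappa> * (a0s^2 - 1))"
    by (rule family_eqI, rule sub) (simp add: relators_def Let_def)
  then show "fas * fw - fw * fas = fh * (fas^2 - 1)"
    by (simp add: commutator_def family_simps fh_def)
  have "family (\<lambda>_. - commutator a0s w0s) = family (\<lambda>\<kappa>. ?s \<kappa> * (a0s^2 - 1))"
    by (rule family_eqI, rule sub) (simp add: relators_def Let_def)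
  then show "- (fas * fws - fws * fas) = fh * (fas^2 - 1)"
    unfolding commutator_def family_simps fh_def .
  have "family (\<lambda>_. commutator w0 w0s) = family (\<lambda>\<kappa>. - (?s \<kappa> * (a0 + a0s) * (w0 + w0s)))"
    by (rule family_eqI, rule sub) (simp add: relators_def Let_def)
  then show "fw * fws - fws * fw = - (fh * (fa + fas) * (fw + fws))"
    unfolding commutator_def family_simps fh_def .
qed

text \<open>
  The relations oriented as rewrite rules: coefficients move to the left, followed by the powers of
  \<open>a0\<close>, then \<open>w0\<close>, then \<open>w0s\<close>.
\<close>

lemma reorder:
  "fa * fas = 1" "fas * fa = 1"
  "fw * fa = fa * fw - fh * (fa * fa - 1)"
  "fws * fa = fa * fws + fh * (fa * fa - 1)"
  "fw * fas = fas * fw - fh * (fas * fas - 1)"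
  "fws * fas = fas * fws + fh * (fas * fas - 1)"
  "fws * fw = fw * fws + fh * ((fa + fas) * (fw + fws))"
  "fa * fh = fh * fa" "fas * fh = fh * fas" "fw * fh = fh * fw" "fws * fh = fh * fws"
  using relators_family by (simp_all add: algebra_simps power2_eq_square fh_def fscal_comm)

text \<open>Extends a rewrite rule for a product to right-associated longer products.\<close>

lemma mult_assoc_rule: "x * y = r \<Longrightarrow> x * (y * z) = r * z" for x :: "'a::semigroup_mult"
  by (simp add: mult.assoc[symmetric])

lemmas normalise = reorder reorder[THEN mult_assoc_rule] power2_eq_square mult_2 mult_2_right

section \<open>Right ideals\<close>

lemma right_ideal_closed:
  assumes "right_ideal J R"
  shows "\<zero>\<^bsub>R\<^esub> \<in> J"
    and "x \<in> J \<Longrightarrow> y \<in> J \<Longrightarrow> x \<oplus>\<^bsub>R\<^esub> y \<in> J"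
    and "x \<in> J \<Longrightarrow> r \<in> carrier R \<Longrightarrow> x \<otimes>\<^bsub>R\<^esub> r \<in> J"
    and "J \<subseteq> carrier R"
proof -
  interpret J: additive_subgroup J R
    using assms by (simp add: right_ideal_def)
  show "\<zero>\<^bsub>R\<^esub> \<in> J" "J \<subseteq> carrier R"
    by (rule J.zero_closed, rule J.a_subset)
  show "x \<in> J \<Longrightarrow> y \<in> J \<Longrightarrow> x \<oplus>\<^bsub>R\<^esub> y \<in> J"
    by (rule J.a_closed)
  show "x \<in> J \<Longrightarrow> r \<in> carrier R \<Longrightarrow> x \<otimes>\<^bsub>R\<^esub> r \<in> J"
    using assms by (simp add: right_ideal_def)
qed

lemma right_idealI:
  assumes "Ring.ring R" "J \<subseteq> carrier R" "\<zero>\<^bsub>R\<^esub> \<in> J"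
    and add: "\<And>x y. x \<in> J \<Longrightarrow> y \<in> J \<Longrightarrow> x \<oplus>\<^bsub>R\<^esub> y \<in> J"
    and mult: "\<And>x r. x \<in> J \<Longrightarrow> r \<in> carrier R \<Longrightarrow> x \<otimes>\<^bsub>R\<^esub> r \<in> J"
  shows "right_ideal J R"
proof -
  interpret R: Ring.ring R by fact
  have "subgroup J (add_monoid R)"
  proof (rule group.subgroupI)
    show "Group.group (add_monoid R)"
      by (rule R.add.is_group)
    fix x assume x: "x \<in> J"
    then have "x \<otimes>\<^bsub>R\<^esub> (\<ominus>\<^bsub>R\<^esub> \<one>\<^bsub>R\<^esub>) \<in> J"
      by (intro mult) auto
    then show "inv\<^bsub>add_monoid R\<^esub> x \<in> J"
      using x assms(2) by (auto simp: R.r_minus a_inv_def[symmetric])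
  qed (use assms in auto)
  then show ?thesis
    using mult by (simp add: right_ideal_def additive_subgroup_def)
qed

lemma gen_right_ideal_incl: "S \<subseteq> gen_right_ideal R S"
  by (auto simp: gen_right_ideal_def)

lemma gen_right_ideal_minimal: "right_ideal J R \<Longrightarrow> S \<subseteq> J \<Longrightarrow> gen_right_ideal R S \<subseteq> J"
  by (auto simp: gen_right_ideal_def)

lemma right_ideal_gen_right_ideal:
  assumes R: "Ring.ring R" and S: "S \<subseteq> carrier R"
  shows "right_ideal (gen_right_ideal R S) R"
proof -
  interpret R: Ring.ring R by fact
  have "right_ideal (carrier R) R"
    using R by (intro right_idealI) auto
  then have "gen_right_ideal R S \<subseteq> carrier R"
    using S by (rule gen_right_ideal_minimal)
  then show ?thesis
    by (intro right_idealI[OF R]) (auto simp: gen_right_ideal_def right_ideal_closed)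
qed

lemma value_at_E_kappa_subring:
  shows "value_at \<kappa> 1 \<in> carrier (E_kappa \<kappa>)"
    and "value_at \<kappa> x \<in> carrier (E_kappa \<kappa>) \<Longrightarrow> value_at \<kappa> (- x) \<in> carrier (E_kappa \<kappa>)"
    and "value_at \<kappa> x \<in> carrier (E_kappa \<kappa>) \<Longrightarrow> value_at \<kappa> y \<in> carrier (E_kappa \<kappa>) \<Longrightarrow>
      value_at \<kappa> (x + y) \<in> carrier (E_kappa \<kappa>)"
    and "value_at \<kappa> x \<in> carrier (E_kappa \<kappa>) \<Longrightarrow> value_at \<kappa> y \<in> carrier (E_kappa \<kappa>) \<Longrightarrow>
      value_at \<kappa> (x * y) \<in> carrier (E_kappa \<kappa>)"
  by (simp_all add: E_kappa_def value_at_one value_at_uminus value_at_add value_at_mult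
      generate_ring.intros)

lemma carrier_E_kappa_subset: "carrier (E_kappa \<kappa>) \<subseteq> carrier (E_tilde \<kappa>)"
proof -
  interpret Ring.ring "E_tilde \<kappa>" by (rule ring_E_tilde)
  show ?thesis
    using generate_ring_incl[of "cls \<kappa> ` (range scalar \<union> {elem_A, elem_As, v_plus, v_minus})"]
    by (simp add: E_kappa_def cls_closed image_subset_iff)
qed

text \<open>
  An additive subgroup \<open>K\<close> of a ring, stable under right multiplication by a subring \<open>S\<close>.  It is applied
  to the set \<open>K\<close> of families whose value at \<open>\<kappa>\<close> lies in a given right ideal; \<open>S\<close> is then everything, for
  ideals of the covering, or the set of families with value in the subalgebra.
\<close>

locale right_ideal_over =
  fixes K S :: "'a::ring_1 set"
  assumes zero: "0 \<in> K"
    and add: "x \<in> K \<Longrightarrow> y \<in> K \<Longrightarrow> x + y \<in> K"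
    and mult: "x \<in> K \<Longrightarrow> s \<in> S \<Longrightarrow> x * s \<in> K"
    and S_one: "1 \<in> S"
    and S_uminus: "s \<in> S \<Longrightarrow> - s \<in> S"
    and S_add: "s \<in> S \<Longrightarrow> t \<in> S \<Longrightarrow> s + t \<in> S"
    and S_mult: "s \<in> S \<Longrightarrow> t \<in> S \<Longrightarrow> s * t \<in> S"
begin

lemma uminus: "x \<in> K \<Longrightarrow> - x \<in> K"
  using mult[of x "- 1"] S_one S_uminus by simp

lemma diff: "x \<in> K \<Longrightarrow> y \<in> K \<Longrightarrow> x - y \<in> K"
  using add[of x "- y"] uminus by simp

lemma S_diff: "s \<in> S \<Longrightarrow> t \<in> S \<Longrightarrow> s - t \<in> S"
  using S_add[of s "- t"] S_uminus by simp

lemmas closed = add diff mult S_one S_add S_diff S_mult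

end

text \<open>
  The generators of the subalgebra, \<open>v_plus\<close> and \<open>v_minus\<close> being called \<open>V\<close> and \<open>U\<close>, the imaginary unit,
  and the coefficient \<open>\<i> / \<kappa>\<close> of the relations between them.
\<close>

definition eA where "eA = family (\<lambda>_. elem_A)"
definition eAs where "eAs = family (\<lambda>_. elem_As)"
definition eV where "eV = family (\<lambda>_. v_plus)"
definition eU where "eU = family (\<lambda>_. v_minus)"
definition fi where "fi = fscal (\<lambda>_. \<i>)"
definition ec where "ec = fscal (\<lambda>\<kappa>. \<i> / complex_of_real \<kappa>)"

lemma e_altdefs: "eA = fa^2" "eAs = fas^2" "eV = - (fi * fa * fw)" "eU = fi * fws * fas"
  "ec = fi * (fh + fh)"
proof -
  show "eA = fa^2" "eAs = fas^2" "eV = - (fi * fa * fw)" "eU = fi * fws * fas"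
    by (simp_all add: eA_def elem_A_def eAs_def elem_As_def eV_def v_plus_def eU_def v_minus_def
        family_simps fscal_uminus fi_def)
  have "ec = fscal (\<lambda>\<kappa>. \<i> * (complex_of_real (1 / (2 * \<kappa>)) + complex_of_real (1 / (2 * \<kappa>))))"
    by (simp add: ec_def)
  also have "\<dots> = fi * (fh + fh)"
    by (simp only: fscal_mult fscal_add fi_def fh_def)
  finally show "ec = fi * (fh + fh)" .
qed

lemma fi_square: "fi * fi = - 1"
proof -
  have "fi * fi = fscal (\<lambda>_. - 1)"
    unfolding fi_def fscal_mult[symmetric] by simp
  then show ?thesis
    by (simp only: fscal_uminus fscal_one)
qed

lemma normalise_fi: "fa * fi = fi * fa" "fas * fi = fi * fas" "fw * fi = fi * fw" "fws * fi = fi * fws"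
   "fh * fi = fi * fh" "fi * fi = - 1"
  unfolding fh_def fi_def by (rule fscal_comm)+ (rule fi_square[unfolded fi_def])

lemmas normalise' = normalise normalise_fi normalise_fi[THEN mult_assoc_rule]

text \<open>
  The relations of the subalgebra, oriented towards the order \<open>A\<close>, \<open>V\<close>, \<open>U\<close>.
\<close>

lemma eA_eAs: "eA * eAs = 1" "eAs * eA = 1"
  and eV_eA: "eV * eA = eA * eV - ec * (eA - eA * eA)"
  and eU_eA: "eU * eA = eA * eU - ec * (1 - eA)"
  and eV_eAs: "eV * eAs = eAs * eV - ec * (1 - eAs)"
  and eU_eAs: "eU * eAs = eAs * eU - ec * (eAs - eAs * eAs)"
  and eU_eV: "eU * eV = eV * eU - ec * (eU - eV)"
  by (simp_all add: e_altdefs normalise' algebra_simps)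

section \<open>The right ideal of the calculus lies in both contracted ideals\<close>

text \<open>
  Each generator of the right ideal of the calculus is written explicitly as a right combination of
  generators of the ideal of the covering.  The combinations arise by pulling the generators of the
  latter to the left, using for example \<open>(a0 - 1)\<^sup>2 = (a0 + a0s - 2) a0\<close>.
\<close>

lemma generators_from_plus:
  assumes K: "right_ideal_over K UNIV"
    and g1: "fa + fas - 2 \<in> K"
    and g2: "(fa - 1) * fw \<in> K"
    and g4: "(fa - 1) * fws \<in> K"
    and g5: "(fas - 1) * fws \<in> K"
    and g6: "fw^2 + (fh + fh) * fw \<in> K"
    and g7: "fws^2 - (fh + fh) * fws \<in> K"
  shows "eA + eAs - 2 \<in> K" "(eA - 1) * eV \<in> K" "(eA - 1) * eU \<in> K"
    "eV^2 - ec * eV \<in> K" "eU^2 - ec * eU \<in> K"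
proof -
  interpret right_ideal_over K UNIV by fact
  note r = mult[OF g1 UNIV_I] mult[OF g2 UNIV_I] mult[OF g4 UNIV_I] mult[OF g5 UNIV_I]
    mult[OF g6 UNIV_I] mult[OF g7 UNIV_I]
  have "eA + eAs - 2 = (fa + fas - 2) * (fa + fas + 2)"
    by (simp add: e_altdefs normalise' algebra_simps)
  then show "eA + eAs - 2 \<in> K"
    using r by simp
  have "(eA - 1) * eV = - ((fa - 1) * fw * ((1 + fa) * fi * fa)
      + (fa + fas - 2) * (fh * fi * fa * (fa + 1) * fa)
      + (fa + fas - 2) * (fh * fi * fa * (fa + 1)^2))"
    by (simp add: e_altdefs normalise' algebra_simps)
  then show "(eA - 1) * eV \<in> K"
    by (simp only:) (intro uminus add r)
  have "(eA - 1) * eU = (fa - 1) * fws * ((1 + fa) * fi * fas)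
      - (fa + fas - 2) * (fh * fi * fa * (fa + 1) * fas)"
    by (simp add: e_altdefs normalise' algebra_simps)
  then show "(eA - 1) * eU \<in> K"
    by (simp only:) (intro diff r)
  have "eV^2 - ec * eV = - ((fa - 1) * fw * (fa * fw + fw + fh - fh * fa)
      + (fw^2 + (fh + fh) * fw) * 1 - (fa + fas - 2) * (fh * fh * fa * (fa + 1)))"
    by (simp add: e_altdefs normalise' algebra_simps)
  then show "eV^2 - ec * eV \<in> K"
    by (simp only:) (intro uminus add diff r)
  have "eU^2 - ec * eU = - ((fas - 1) * fws * (fws * fas)
      + (fws^2 - (fh + fh) * fws) * fas + (fas - 1) * fws * ((fh + fh * fas) * fas)
      - (fa + fas - 2) * (fh * fh * fas * (fas + 1) * fas))"
    by (simp add: e_altdefs normalise' algebra_simps)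
  then show "eU^2 - ec * eU \<in> K"
    by (simp only:) (intro uminus add diff r)
qed

text \<open>
  The same for the other ideal, where \<open>(a0 + 1) (a0\<^sup>2 - 1)\<close> is the first generator times \<open>a0\<close>, and its
  counterpart with \<open>a0s\<close> the second generator times \<open>a0s\<close>.
\<close>

lemma generators_from_minus:
  assumes K: "right_ideal_over K UNIV"
    and g1: "fa^2 + fa - fas - 1 \<in> K"
    and g2: "fas^2 + fas - fa - 1 \<in> K"
    and g3: "(fa + 1) * fw \<in> K"
    and g5: "(fa + 1) * fws \<in> K"
    and g6: "(fas + 1) * fws \<in> K"
    and g7: "fw^2 - (fh + fh) * fw \<in> K"
    and g8: "fws^2 + (fh + fh) * fws \<in> K"
  shows "eA + eAs - 2 \<in> K" "(eA - 1) * eV \<in> K" "(eA - 1) * eU \<in> K"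
    "eV^2 - ec * eV \<in> K" "eU^2 - ec * eU \<in> K"
proof -
  interpret right_ideal_over K UNIV by fact
  note r = mult[OF g1 UNIV_I] mult[OF g2 UNIV_I] mult[OF g3 UNIV_I] mult[OF g5 UNIV_I]
    mult[OF g6 UNIV_I] mult[OF g7 UNIV_I] mult[OF g8 UNIV_I]
  have "eA + eAs - 2 = (fa^2 + fa - fas - 1) + (fas^2 + fas - fa - 1)"
    by (simp add: e_altdefs algebra_simps)
  then show "eA + eAs - 2 \<in> K"
    by (simp only:) (intro add g1 g2)
  have "(eA - 1) * eV = - ((fa + 1) * fw * ((fa - 1) * fi * fa)
      + (fa^2 + fa - fas - 1) * (fh * fi * fa * fa)
      + (fa^2 + fa - fas - 1) * (fh * fi * fa * (fa - 1)))"
    by (simp add: e_altdefs normalise' algebra_simps)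
  then show "(eA - 1) * eV \<in> K"
    by (simp only:) (intro uminus add r)
  have "(eA - 1) * eU = (fa + 1) * fws * ((fa - 1) * fi * fas)
      - (fa^2 + fa - fas - 1) * (fh * fi * fa * fas)"
    by (simp add: e_altdefs normalise' algebra_simps)
  then show "(eA - 1) * eU \<in> K"
    by (simp only:) (intro diff r)
  have "eV^2 - ec * eV = - ((fa + 1) * fw * (fa * fw - fw + fh * fa + fh)
      + (fa^2 + fa - fas - 1) * (fh * fh * fa) + (fw^2 - (fh + fh) * fw) * 1)"
    by (simp add: e_altdefs normalise' algebra_simps)
  then show "eV^2 - ec * eV \<in> K"
    by (simp only:) (intro uminus add r)
  have "eU^2 - ec * eU = - ((fas + 1) * fws * (fws * fas)
      - (fws^2 + (fh + fh) * fws) * fas + (fas + 1) * fws * (fh * (fas - 1) * fas)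
      - (fas^2 + fas - fa - 1) * (fh * fh * fas * fas))"
    by (simp add: e_altdefs normalise' algebra_simps)
  then show "eU^2 - ec * eU \<in> K"
    by (simp only:) (intro uminus add diff r)
qed

lemma value_at_right_ideal:
  assumes J: "right_ideal J (E_tilde \<kappa>)"
  shows "right_ideal_over {x. value_at \<kappa> x \<in> J} UNIV"
  by unfold_locales
    (simp_all add: value_at_zero value_at_add value_at_mult right_ideal_closed[OF J] value_at_closed)

lemma value_at_right_ideal_E_kappa:
  assumes J: "right_ideal J (E_kappa \<kappa>)"
  shows "right_ideal_over {x. value_at \<kappa> x \<in> J} {x. value_at \<kappa> x \<in> carrier (E_kappa \<kappa>)}"
proof -
  have ops: "\<zero>\<^bsub>E_kappa \<kappa>\<^esub> = \<zero>\<^bsub>E_tilde \<kappa>\<^esub>" "x \<oplus>\<^bsub>E_kappa \<kappa>\<^esub> y = x \<oplus>\<^bsub>E_tilde \<kappa>\<^esub> y"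
    "x \<otimes>\<^bsub>E_kappa \<kappa>\<^esub> y = x \<otimes>\<^bsub>E_tilde \<kappa>\<^esub> y" for x y
    by (simp_all add: E_kappa_def)
  show ?thesis
    by unfold_locales
      (simp_all add: value_at_E_kappa_subring
        value_at_E_kappa_subring[unfolded value_at_add value_at_mult] value_at_zero value_at_add[of \<kappa>] value_at_mult[of \<kappa>]
        right_ideal_closed[OF J, unfolded ops])
qed

lemma fscal_inverse: "fscal (\<lambda>\<kappa>. complex_of_real (1 / \<kappa>)) = fh + fh"
proof -
  have "fscal (\<lambda>\<kappa>. complex_of_real (1 / \<kappa>)) =
      fscal (\<lambda>\<kappa>. complex_of_real (1 / (2 * \<kappa>)) + complex_of_real (1 / (2 * \<kappa>)))"
    by simp
  then show ?thesis
    by (simp only: fscal_add fh_def)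
qed

lemma R_tilde_plus_generators:
  "value_at \<kappa> (fa + fas - 2) \<in> R_tilde_plus \<kappa>"
  "value_at \<kappa> ((fa - 1) * fw) \<in> R_tilde_plus \<kappa>"
  "value_at \<kappa> ((fa - 1) * fws) \<in> R_tilde_plus \<kappa>"
  "value_at \<kappa> ((fas - 1) * fws) \<in> R_tilde_plus \<kappa>"
  "value_at \<kappa> (fw^2 + (fh + fh) * fw) \<in> R_tilde_plus \<kappa>"
  "value_at \<kappa> (fws^2 - (fh + fh) * fws) \<in> R_tilde_plus \<kappa>"
proof -
  let ?h = "\<lambda>\<kappa>. scalar (complex_of_real (1 / \<kappa>))"
  have "value_at \<kappa> (family f) \<in> R_tilde_plus \<kappa>"
    if "f \<kappa> \<in> {a0 + a0s - 2, (a0 - 1) * w0, (a0s - 1) * w0, (a0 - 1) * w0s, (a0s - 1) * w0s,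
      w0^2 + ?h \<kappa> * w0, w0s^2 - ?h \<kappa> * w0s}" for f
    unfolding value_at_family R_tilde_plus_def Let_def
    by (rule subsetD[OF gen_right_ideal_incl imageI]) (rule that)
  from this[of "\<lambda>_. a0 + a0s - 2"] this[of "\<lambda>_. (a0 - 1) * w0"] this[of "\<lambda>_. (a0 - 1) * w0s"]
    this[of "\<lambda>_. (a0s - 1) * w0s"] this[of "\<lambda>\<kappa>. w0^2 + ?h \<kappa> * w0"]
    this[of "\<lambda>\<kappa>. w0s^2 - ?h \<kappa> * w0s"]
  show "value_at \<kappa> (fa + fas - 2) \<in> R_tilde_plus \<kappa>"
    "value_at \<kappa> ((fa - 1) * fw) \<in> R_tilde_plus \<kappa>"
    "value_at \<kappa> ((fa - 1) * fws) \<in> R_tilde_plus \<kappa>"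
    "value_at \<kappa> ((fas - 1) * fws) \<in> R_tilde_plus \<kappa>"
    "value_at \<kappa> (fw^2 + (fh + fh) * fw) \<in> R_tilde_plus \<kappa>"
    "value_at \<kappa> (fws^2 - (fh + fh) * fws) \<in> R_tilde_plus \<kappa>"
    unfolding family_simps fscal_inverse by blast+
qed

lemma R_tilde_minus_generators:
  "value_at \<kappa> (fa^2 + fa - fas - 1) \<in> R_tilde_minus \<kappa>"
  "value_at \<kappa> (fas^2 + fas - fa - 1) \<in> R_tilde_minus \<kappa>"
  "value_at \<kappa> ((fa + 1) * fw) \<in> R_tilde_minus \<kappa>"
  "value_at \<kappa> ((fa + 1) * fws) \<in> R_tilde_minus \<kappa>"
  "value_at \<kappa> ((fas + 1) * fws) \<in> R_tilde_minus \<kappa>"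
  "value_at \<kappa> (fw^2 - (fh + fh) * fw) \<in> R_tilde_minus \<kappa>"
  "value_at \<kappa> (fws^2 + (fh + fh) * fws) \<in> R_tilde_minus \<kappa>"
proof -
  let ?h = "\<lambda>\<kappa>. scalar (complex_of_real (1 / \<kappa>))"
  have "value_at \<kappa> (family f) \<in> R_tilde_minus \<kappa>"
    if "f \<kappa> \<in> {a0^2 + a0 - a0s - 1, a0s^2 + a0s - a0 - 1, (a0 + 1) * w0, (a0s + 1) * w0,
      (a0 + 1) * w0s, (a0s + 1) * w0s, w0^2 - ?h \<kappa> * w0, w0s^2 + ?h \<kappa> * w0s,
      w0 * w0s - ?h \<kappa> * w0 - (?h \<kappa>)^2 * (a0s - 1)}" for f
    unfolding value_at_family R_tilde_minus_def Let_def
    by (rule subsetD[OF gen_right_ideal_incl imageI]) (rule that)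
  from this[of "\<lambda>_. a0^2 + a0 - a0s - 1"] this[of "\<lambda>_. a0s^2 + a0s - a0 - 1"]
    this[of "\<lambda>_. (a0 + 1) * w0"] this[of "\<lambda>_. (a0 + 1) * w0s"] this[of "\<lambda>_. (a0s + 1) * w0s"]
    this[of "\<lambda>\<kappa>. w0^2 - ?h \<kappa> * w0"] this[of "\<lambda>\<kappa>. w0s^2 + ?h \<kappa> * w0s"]
  show "value_at \<kappa> (fa^2 + fa - fas - 1) \<in> R_tilde_minus \<kappa>"
    "value_at \<kappa> (fas^2 + fas - fa - 1) \<in> R_tilde_minus \<kappa>"
    "value_at \<kappa> ((fa + 1) * fw) \<in> R_tilde_minus \<kappa>"
    "value_at \<kappa> ((fa + 1) * fws) \<in> R_tilde_minus \<kappa>"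
    "value_at \<kappa> ((fas + 1) * fws) \<in> R_tilde_minus \<kappa>"
    "value_at \<kappa> (fw^2 - (fh + fh) * fw) \<in> R_tilde_minus \<kappa>"
    "value_at \<kappa> (fws^2 + (fh + fh) * fws) \<in> R_tilde_minus \<kappa>"
    unfolding family_simps fscal_inverse by blast+
qed

lemma value_at_E_kappa_generators:
  "value_at \<kappa> (fscal f) \<in> carrier (E_kappa \<kappa>)" "value_at \<kappa> eA \<in> carrier (E_kappa \<kappa>)"
  "value_at \<kappa> eAs \<in> carrier (E_kappa \<kappa>)" "value_at \<kappa> eV \<in> carrier (E_kappa \<kappa>)"
  "value_at \<kappa> eU \<in> carrier (E_kappa \<kappa>)"
  by (auto simp: fscal_def eA_def eAs_def eV_def eU_def E_kappa_def intro!: generate_ring.incl)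

lemma right_ideal_R_4D: "right_ideal (R_4D \<kappa>) (E_kappa \<kappa>)"
  and R_4D_generators:
    "value_at \<kappa> (eA + eAs - 2) \<in> R_4D \<kappa>"
    "value_at \<kappa> ((eA - 1) * eV) \<in> R_4D \<kappa>"
    "value_at \<kappa> ((eA - 1) * eU) \<in> R_4D \<kappa>"
    "value_at \<kappa> (eV^2 - ec * eV) \<in> R_4D \<kappa>"
    "value_at \<kappa> (eU^2 - ec * eU) \<in> R_4D \<kappa>"
  and R_4D_minimal: "right_ideal J (E_kappa \<kappa>) \<Longrightarrow>
    value_at \<kappa> (eA + eAs - 2) \<in> J \<Longrightarrow> value_at \<kappa> ((eA - 1) * eV) \<in> J \<Longrightarrow>
    value_at \<kappa> ((eA - 1) * eU) \<in> J \<Longrightarrow> value_at \<kappa> (eV^2 - ec * eV) \<in> J \<Longrightarrow>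
    value_at \<kappa> (eU^2 - ec * eU) \<in> J \<Longrightarrow> R_4D \<kappa> \<subseteq> J"
proof -
  let ?ih = "\<lambda>\<kappa>. scalar (\<i> / complex_of_real \<kappa>)"
  let ?G = "{value_at \<kappa> (eA + eAs - 2), value_at \<kappa> ((eA - 1) * eV), value_at \<kappa> ((eA - 1) * eU),
     value_at \<kappa> (eV^2 - ec * eV), value_at \<kappa> (eU^2 - ec * eU)}"
  note v = value_at_family[of \<kappa>, symmetric]
  have "cls \<kappa> ` {elem_A + elem_As - 2, (elem_A - 1) * v_plus, (elem_A - 1) * v_minus,
      v_plus^2 - ?ih \<kappa> * v_plus, v_minus^2 - ?ih \<kappa> * v_minus} = ?G"
    unfolding image_insert image_empty
      v[of "\<lambda>_. elem_A + elem_As - 2"] v[of "\<lambda>_. (elem_A - 1) * v_plus"]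
      v[of "\<lambda>_. (elem_A - 1) * v_minus"] v[of "\<lambda>\<kappa>. v_plus^2 - ?ih \<kappa> * v_plus"]
      v[of "\<lambda>\<kappa>. v_minus^2 - ?ih \<kappa> * v_minus"]
      family_simps eA_def[symmetric] eAs_def[symmetric] eV_def[symmetric] eU_def[symmetric]
      ec_def[symmetric] ..
  then have R: "R_4D \<kappa> = gen_right_ideal (E_kappa \<kappa>) ?G"
    unfolding R_4D_def Let_def by simp
  note S = value_at_E_kappa_subring[of \<kappa>] value_at_E_kappa_generators[of \<kappa>]
  have diff: "value_at \<kappa> (x - y) \<in> carrier (E_kappa \<kappa>)"
    if "value_at \<kappa> x \<in> carrier (E_kappa \<kappa>)" "value_at \<kappa> y \<in> carrier (E_kappa \<kappa>)" for x y
    using S(3)[OF that(1) S(2)[OF that(2)]] by simp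
  have "?G \<subseteq> carrier (E_kappa \<kappa>)"
    by (auto simp: ec_def power2_eq_square one_add_one[symmetric] simp del: one_add_one
        intro!: diff S)
  then show "right_ideal (R_4D \<kappa>) (E_kappa \<kappa>)"
    unfolding R by (rule right_ideal_gen_right_ideal[OF ring_E_kappa])
  show "value_at \<kappa> (eA + eAs - 2) \<in> R_4D \<kappa>"
    "value_at \<kappa> ((eA - 1) * eV) \<in> R_4D \<kappa>"
    "value_at \<kappa> ((eA - 1) * eU) \<in> R_4D \<kappa>"
    "value_at \<kappa> (eV^2 - ec * eV) \<in> R_4D \<kappa>"
    "value_at \<kappa> (eU^2 - ec * eU) \<in> R_4D \<kappa>"
    using gen_right_ideal_incl[of ?G "E_kappa \<kappa>"] unfolding R by blast+
  show "R_4D \<kappa> \<subseteq> J" if "right_ideal J (E_kappa \<kappa>)"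
    "value_at \<kappa> (eA + eAs - 2) \<in> J" "value_at \<kappa> ((eA - 1) * eV) \<in> J"
    "value_at \<kappa> ((eA - 1) * eU) \<in> J" "value_at \<kappa> (eV^2 - ec * eV) \<in> J"
    "value_at \<kappa> (eU^2 - ec * eU) \<in> J"
    unfolding R using that by (intro gen_right_ideal_minimal) blast+
qed

lemma right_ideal_inter_E_kappa:
  assumes "right_ideal J (E_tilde \<kappa>)"
  shows "right_ideal (J \<inter> carrier (E_kappa \<kappa>)) (E_kappa \<kappa>)"
proof (rule right_idealI[OF ring_E_kappa])
  interpret E: Ring.ring "E_kappa \<kappa>" by (rule ring_E_kappa)
  have ops: "\<zero>\<^bsub>E_kappa \<kappa>\<^esub> = \<zero>\<^bsub>E_tilde \<kappa>\<^esub>" "x \<oplus>\<^bsub>E_kappa \<kappa>\<^esub> y = x \<oplus>\<^bsub>E_tilde \<kappa>\<^esub> y"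
    "x \<otimes>\<^bsub>E_kappa \<kappa>\<^esub> y = x \<otimes>\<^bsub>E_tilde \<kappa>\<^esub> y" for x y
    by (simp_all add: E_kappa_def)
  note J = right_ideal_closed[OF assms, folded ops]
  show "J \<inter> carrier (E_kappa \<kappa>) \<subseteq> carrier (E_kappa \<kappa>)" by blast
  show "\<zero>\<^bsub>E_kappa \<kappa>\<^esub> \<in> J \<inter> carrier (E_kappa \<kappa>)"
    using J(1) by simp
  show "x \<oplus>\<^bsub>E_kappa \<kappa>\<^esub> y \<in> J \<inter> carrier (E_kappa \<kappa>)"
    if "x \<in> J \<inter> carrier (E_kappa \<kappa>)" "y \<in> J \<inter> carrier (E_kappa \<kappa>)" for x y
    using that J(2) by simp
  show "x \<otimes>\<^bsub>E_kappa \<kappa>\<^esub> r \<in> J \<inter> carrier (E_kappa \<kappa>)"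
    if "x \<in> J \<inter> carrier (E_kappa \<kappa>)" "r \<in> carrier (E_kappa \<kappa>)" for x r
    using that J(3) carrier_E_kappa_subset[of \<kappa>] by auto
qed

lemma right_ideal_R_tilde:
  "right_ideal (R_tilde_plus \<kappa>) (E_tilde \<kappa>)" "right_ideal (R_tilde_minus \<kappa>) (E_tilde \<kappa>)"
  unfolding R_tilde_plus_def R_tilde_minus_def Let_def
  by (rule right_ideal_gen_right_ideal[OF ring_E_tilde], use cls_closed in blast)+

lemma R_4D_subset_plus: "R_4D \<kappa> \<subseteq> R_tilde_plus \<kappa> \<inter> carrier (E_kappa \<kappa>)"
proof -
  note J = right_ideal_inter_E_kappa[OF right_ideal_R_tilde(1)[of \<kappa>]]
  note g = generators_from_plus[OF value_at_right_ideal[OF right_ideal_R_tilde(1)[of \<kappa>]],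
      unfolded mem_Collect_eq, OF R_tilde_plus_generators]
  show ?thesis
    by (rule R_4D_minimal[OF J])
      (use g R_4D_generators right_ideal_closed(4)[OF right_ideal_R_4D] in blast)+
qed

lemma R_4D_subset_minus: "R_4D \<kappa> \<subseteq> R_tilde_minus \<kappa> \<inter> carrier (E_kappa \<kappa>)"
proof -
  note J = right_ideal_inter_E_kappa[OF right_ideal_R_tilde(2)[of \<kappa>]]
  note g = generators_from_minus[OF value_at_right_ideal[OF right_ideal_R_tilde(2)[of \<kappa>]],
      unfolded mem_Collect_eq, OF R_tilde_minus_generators]
  show ?thesis
    by (rule R_4D_minimal[OF J])
      (use g R_4D_generators right_ideal_closed(4)[OF right_ideal_R_4D] in blast)+
qed

section \<open>The subalgebra modulo the right ideal of the calculus\<close>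

context
  fixes \<kappa> :: real
begin

text \<open>
  The family \<open>x\<close> is, at \<open>\<kappa>\<close> and modulo the right ideal of the calculus, a complex combination of \<open>1\<close>, \<open>A\<close>,
  \<open>V\<close>, \<open>U\<close> and \<open>V U\<close>.  The coefficients are families of scalars, of which only the value at \<open>\<kappa>\<close> matters.
\<close>

definition normal_form :: "covering_family \<Rightarrow> bool" where
  "normal_form x \<longleftrightarrow> (\<exists>f0 f1 f2 f3 f4. value_at \<kappa> (x -
     (fscal f0 + fscal f1 * eA + fscal f2 * eV + fscal f3 * eU + fscal f4 * (eV * eU))) \<in> R_4D \<kappa>)"

interpretation R: right_ideal_over "{x. value_at \<kappa> x \<in> R_4D \<kappa>}"
  "{x. value_at \<kappa> x \<in> carrier (E_kappa \<kappa>)}"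
  by (rule value_at_right_ideal_E_kappa[OF right_ideal_R_4D])

lemmas R_closed = R.closed[unfolded mem_Collect_eq]

lemma R_4D_fscal: "value_at \<kappa> x \<in> R_4D \<kappa> \<Longrightarrow> value_at \<kappa> (fscal f * x) \<in> R_4D \<kappa>"
  using R_closed(3)[of x "fscal f"] value_at_E_kappa_generators(1) by (simp add: fscal_comm)

lemma normal_form_add:
  assumes "normal_form x" "normal_form y"
  shows "normal_form (x + y)"
proof -
  obtain f0 f1 f2 f3 f4 g0 g1 g2 g3 g4 where
    *: "value_at \<kappa> (x - (fscal f0 + fscal f1 * eA + fscal f2 * eV + fscal f3 * eU
        + fscal f4 * (eV * eU))) \<in> R_4D \<kappa>" (is "value_at \<kappa> ?x \<in> _")
       "value_at \<kappa> (y - (fscal g0 + fscal g1 * eA + fscal g2 * eV + fscal g3 * eU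
        + fscal g4 * (eV * eU))) \<in> R_4D \<kappa>" (is "value_at \<kappa> ?y \<in> _")
    using assms unfolding normal_form_def by blast
  let ?z = "x + y - (fscal (\<lambda>\<kappa>. f0 \<kappa> + g0 \<kappa>) + fscal (\<lambda>\<kappa>. f1 \<kappa> + g1 \<kappa>) * eA
    + fscal (\<lambda>\<kappa>. f2 \<kappa> + g2 \<kappa>) * eV + fscal (\<lambda>\<kappa>. f3 \<kappa> + g3 \<kappa>) * eU
    + fscal (\<lambda>\<kappa>. f4 \<kappa> + g4 \<kappa>) * (eV * eU))"
  have "?x + ?y = ?z"
    by (simp add: fscal_add algebra_simps)
  then have "value_at \<kappa> ?z \<in> R_4D \<kappa>"
    using R_closed(1)[OF *] by (simp only:)
  then show ?thesis
    unfolding normal_form_def by blast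
qed

lemma normal_form_fscal:
  assumes "normal_form x"
  shows "normal_form (fscal g * x)"
proof -
  obtain f0 f1 f2 f3 f4 where
    *: "value_at \<kappa> (x - (fscal f0 + fscal f1 * eA + fscal f2 * eV + fscal f3 * eU
        + fscal f4 * (eV * eU))) \<in> R_4D \<kappa>" (is "value_at \<kappa> ?x \<in> _")
    using assms unfolding normal_form_def by blast
  let ?z = "fscal g * x - (fscal (\<lambda>\<kappa>. g \<kappa> * f0 \<kappa>) + fscal (\<lambda>\<kappa>. g \<kappa> * f1 \<kappa>) * eA
    + fscal (\<lambda>\<kappa>. g \<kappa> * f2 \<kappa>) * eV + fscal (\<lambda>\<kappa>. g \<kappa> * f3 \<kappa>) * eU
    + fscal (\<lambda>\<kappa>. g \<kappa> * f4 \<kappa>) * (eV * eU))"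
  have "fscal g * ?x = ?z"
    by (simp only: fscal_mult right_diff_distrib distrib_left mult.assoc)
  then have "value_at \<kappa> ?z \<in> R_4D \<kappa>"
    using R_4D_fscal[OF *, of g] by simp
  then show ?thesis
    unfolding normal_form_def by blast
qed

lemma fscal_zero: "fscal (\<lambda>_. 0) = 0"
  using fscal_add[of "\<lambda>_. 0" "\<lambda>_. 0"] by simp

lemma normal_form_R_4D: "value_at \<kappa> x \<in> R_4D \<kappa> \<Longrightarrow> normal_form x"
  unfolding normal_form_def by (rule exI[of _ "\<lambda>_. 0"])+ (simp add: fscal_zero)

lemma normal_form_basis:
  "normal_form 1" "normal_form eA" "normal_form eV" "normal_form eU" "normal_form (eV * eU)"
proof -
  let ?o = "\<lambda>_ :: real. 0 :: complex" and ?i = "\<lambda>_ :: real. 1 :: complex"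
  have 0: "value_at \<kappa> 0 \<in> R_4D \<kappa>"
    using R.zero by simp
  note s = fscal_zero fscal_one
  show "normal_form 1" unfolding normal_form_def
    by (rule exI[of _ ?i], rule exI[of _ ?o], rule exI[of _ ?o], rule exI[of _ ?o],
        rule exI[of _ ?o]) (use 0 in \<open>simp add: s\<close>)
  show "normal_form eA" unfolding normal_form_def
    by (rule exI[of _ ?o], rule exI[of _ ?i], rule exI[of _ ?o], rule exI[of _ ?o],
        rule exI[of _ ?o]) (use 0 in \<open>simp add: s\<close>)
  show "normal_form eV" unfolding normal_form_def
    by (rule exI[of _ ?o], rule exI[of _ ?o], rule exI[of _ ?i], rule exI[of _ ?o],
        rule exI[of _ ?o]) (use 0 in \<open>simp add: s\<close>)
  show "normal_form eU" unfolding normal_form_def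
    by (rule exI[of _ ?o], rule exI[of _ ?o], rule exI[of _ ?o], rule exI[of _ ?i],
        rule exI[of _ ?o]) (use 0 in \<open>simp add: s\<close>)
  show "normal_form (eV * eU)" unfolding normal_form_def
    by (rule exI[of _ ?o], rule exI[of _ ?o], rule exI[of _ ?o], rule exI[of _ ?o],
        rule exI[of _ ?i]) (use 0 in \<open>simp add: s\<close>)
qed

lemma normal_form_uminus: "normal_form x \<Longrightarrow> normal_form (- x)"
  using normal_form_fscal[of x "\<lambda>_. - 1"] by (simp add: fscal_uminus[of "\<lambda>_. 1"] fscal_one)

lemma normal_form_diff: "normal_form x \<Longrightarrow> normal_form y \<Longrightarrow> normal_form (x - y)"
  using normal_form_add[of x "- y"] by (simp add: normal_form_uminus)

lemma normal_form_ec: "normal_form x \<Longrightarrow> normal_form (ec * x)"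
  unfolding ec_def by (rule normal_form_fscal)

lemma normal_form_mult:
  assumes x: "normal_form x" and g: "value_at \<kappa> g \<in> carrier (E_kappa \<kappa>)"
    and b: "normal_form g" "normal_form (eA * g)" "normal_form (eV * g)" "normal_form (eU * g)"
      "normal_form (eV * eU * g)"
  shows "normal_form (x * g)"
proof -
  obtain f0 f1 f2 f3 f4 where
    *: "value_at \<kappa> (x - (fscal f0 + fscal f1 * eA + fscal f2 * eV + fscal f3 * eU
        + fscal f4 * (eV * eU))) \<in> R_4D \<kappa>" (is "value_at \<kappa> ?x \<in> _")
    using x unfolding normal_form_def by blast
  have "x * g = ?x * g + fscal f0 * g + fscal f1 * (eA * g) + fscal f2 * (eV * g)
      + fscal f3 * (eU * g) + fscal f4 * (eV * eU * g)"
    by (simp add: algebra_simps)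
  also have "normal_form \<dots>"
    by (intro normal_form_add normal_form_fscal b normal_form_R_4D R_closed * g)
  finally show ?thesis .
qed

lemma ec_comm: "x * ec = ec * x"
  unfolding ec_def by (rule fscal_comm)

lemmas normalise_e = eA_eAs eV_eA eU_eA eV_eAs eU_eAs eU_eV
  ec_comm[of eA] ec_comm[of eAs] ec_comm[of eV] ec_comm[of eU]

lemmas normalise_e' = normalise_e normalise_e[THEN mult_assoc_rule] power2_eq_square mult_2 mult_2_right

text \<open>
  Multiplying the five spanning elements on the right by generators does not leave their span.  In
  each equation the summands with a factor \<open>r1\<close>, ..., \<open>r5\<close> lie in the right ideal and the others give
  the normal form.
\<close>

lemma normal_form_products:
    "normal_form (eA * eA)" "normal_form (eV * eA)" "normal_form (eU * eA)"
    "normal_form (eV * eU * eA)"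
    "normal_form eAs" "normal_form (eA * eAs)" "normal_form (eV * eAs)"
    "normal_form (eU * eAs)" "normal_form (eV * eU * eAs)"
    "normal_form (eA * eV)" "normal_form (eV * eV)" "normal_form (eU * eV)"
    "normal_form (eV * eU * eV)"
    "normal_form (eA * eU)" "normal_form (eU * eU)" "normal_form (eV * eU * eU)"
proof -
  define r1 where "r1 = eA + eAs - 2"
  define r2 where "r2 = (eA - 1) * eV"
  define r3 where "r3 = (eA - 1) * eU"
  define r4 where "r4 = eV^2 - ec * eV"
  define r5 where "r5 = eU^2 - ec * eU"
  have ec: "value_at \<kappa> ec \<in> carrier (E_kappa \<kappa>)"
    unfolding ec_def by (rule value_at_E_kappa_generators)
  note r = R_4D_generators[of \<kappa>, folded r1_def r2_def r3_def r4_def r5_def]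
  note nf = normal_form_add normal_form_diff normal_form_uminus normal_form_ec normal_form_basis
    normal_form_R_4D
  note cl = R_closed r value_at_E_kappa_generators ec
  note eq = r1_def r2_def r3_def r4_def r5_def normalise_e' algebra_simps
  have "eA * eA = eA + eA - 1 + r1 * eA"
    by (simp add: eq)
  then show "normal_form (eA * eA)"
    by (simp only:) (intro nf cl)
  have "eV * eA = eV + ec * (eA - 1) + (r2 + r1 * (ec * eA))"
    by (simp add: eq)
  then show "normal_form (eV * eA)"
    by (simp only:) (intro nf cl)
  have "eU * eA = eU + ec * (eA - 1) + r3"
    by (simp add: eq)
  then show "normal_form (eU * eA)"
    by (simp only:) (intro nf cl)
  have "eV * eU * eA = eV * eU + ec * (ec * (eA - 1))
      + (r3 * ec + r2 * (eU + ec) + r1 * (ec * eA * eU + ec * ec * eA))"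
    by (simp add: eq)
  then show "normal_form (eV * eU * eA)"
    by (simp only:) (intro nf cl)
  have "eAs = 1 + 1 - eA + r1"
    by (simp add: r1_def)
  then show "normal_form eAs"
    by (rule ssubst) (intro nf cl)
  show "normal_form (eA * eAs)"
    by (simp only: eA_eAs normal_form_basis)
  have "eV * eAs = eV - ec * (eA - 1) + (r1 * (eV + ec) - r2)"
    by (simp add: eq)
  then show "normal_form (eV * eAs)"
    by (simp only:) (intro nf cl)
  have "eU * eAs = eU - ec * (eA - 1) + (r1 * (eU + ec + ec * eAs) - r3)"
    by (simp add: eq)
  then show "normal_form (eU * eAs)"
    by (simp only:) (intro nf cl)
  have "eV * eU * eAs = eV * eU - ec * (ec * (eA - 1))
      + (r1 * (eV * eU + ec * eU + ec * eV + ec * ec + ec * ec - (eV + ec) * ec * (1 - eAs))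
        - r3 * ec - r2 * (eU + ec - ec * (1 - eAs)))"
    by (simp add: eq)
  then show "normal_form (eV * eU * eAs)"
    by (simp only:) (intro nf cl)
  have "eA * eV = eV + r2"
    by (simp add: eq)
  then show "normal_form (eA * eV)"
    by (simp only:) (intro nf cl)
  have "eV * eV = ec * eV + r4"
    by (simp add: eq)
  then show "normal_form (eV * eV)"
    by (simp only:) (intro nf cl)
  have "eU * eV = eV * eU - ec * (eU - eV)"
    by (rule eU_eV)
  then show "normal_form (eU * eV)"
    by (simp only:) (intro nf cl)
  have "eV * eU * eV = ec * (ec * eV) + r4 * (eU + ec)"
    by (simp add: eq)
  then show "normal_form (eV * eU * eV)"
    by (simp only:) (intro nf cl)
  have "eA * eU = eU + r3"
    by (simp add: eq)
  then show "normal_form (eA * eU)"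
    by (simp only:) (intro nf cl)
  have "eU * eU = ec * eU + r5"
    by (simp add: eq)
  then show "normal_form (eU * eU)"
    by (simp only:) (intro nf cl)
  have "eV * eU * eU = ec * (ec * eU) + ec * (ec * eU) - ec * (eV * eU) + r5 * (eV + ec + ec)"
    by (simp add: eq)
  then show "normal_form (eV * eU * eU)"
    by (simp only:) (intro nf cl)
qed

lemma normal_form_mult_right:
  assumes "normal_form x"
  shows "normal_form (x * eA)" "normal_form (x * eAs)" "normal_form (x * eV)" "normal_form (x * eU)"
  by (rule normal_form_mult[OF assms]; intro value_at_E_kappa_generators normal_form_basis
      normal_form_products)+

text \<open>
  The elements by which normal forms may be multiplied on the right form a subring, so it is enough
  that it contains the generators.
\<close>

lemma E_kappa_normal_form:
  assumes "Y \<in> carrier (E_kappa \<kappa>)"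
  shows "\<exists>y. Y = value_at \<kappa> y \<and> normal_form y"
proof -
  have "Y \<in> generate_ring (E_tilde \<kappa>)
      (cls \<kappa> ` (range scalar \<union> {elem_A, elem_As, v_plus, v_minus}))"
    using assms by (simp add: E_kappa_def)
  then have "\<exists>y. Y = value_at \<kappa> y \<and> (\<forall>x. normal_form x \<longrightarrow> normal_form (x * y))"
  proof (induction rule: generate_ring.induct)
    case one
    show ?case
      by (rule exI[of _ 1]) (simp add: value_at_one)
  next
    case (incl Y)
    then consider c where "Y = cls \<kappa> (scalar c)" | "Y = value_at \<kappa> eA" | "Y = value_at \<kappa> eAs"
      | "Y = value_at \<kappa> eV" | "Y = value_at \<kappa> eU"
      by (auto simp: eA_def eAs_def eV_def eU_def)
    then show ?case
    proof cases
      case (1 c)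
      then have "Y = value_at \<kappa> (fscal (\<lambda>_. c))"
        by (simp add: fscal_def)
      then show ?thesis
        by (intro exI[of _ "fscal (\<lambda>_. c)"]) (auto simp: fscal_comm intro: normal_form_fscal)
    qed (use normal_form_mult_right in blast)+
  next
    case (a_inv Y)
    then obtain y where "Y = value_at \<kappa> y" "\<forall>x. normal_form x \<longrightarrow> normal_form (x * y)" by blast
    then show ?case
      by (intro exI[of _ "- y"]) (simp add: value_at_uminus normal_form_uminus)
  next
    case (eng_add Y Z)
    then obtain y z where "Y = value_at \<kappa> y" "\<forall>x. normal_form x \<longrightarrow> normal_form (x * y)"
      "Z = value_at \<kappa> z" "\<forall>x. normal_form x \<longrightarrow> normal_form (x * z)" by blast
    then show ?case
      by (intro exI[of _ "y + z"]) (simp add: value_at_add distrib_left normal_form_add)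
  next
    case (eng_mult Y Z)
    then obtain y z where "Y = value_at \<kappa> y" "\<forall>x. normal_form x \<longrightarrow> normal_form (x * y)"
      "Z = value_at \<kappa> z" "\<forall>x. normal_form x \<longrightarrow> normal_form (x * z)" by blast
    then show ?case
      by (intro exI[of _ "y * z"]) (simp add: value_at_mult mult.assoc[symmetric])
  qed
  then show ?thesis
    using normal_form_basis(1) by (metis mult_1)
qed

end

section \<open>The intersections\<close>

lemma (in free_alg_right_module) act_gen_right_ideal:
  assumes I: "\<And>x v. x \<in> relation_ideal \<kappa> \<Longrightarrow> act v x = 0"
    and S: "\<And>x. x \<in> S \<Longrightarrow> act e x = 0"
    and x: "cls \<kappa> x \<in> gen_right_ideal (E_tilde \<kappa>) (cls \<kappa> ` S)"
  shows "act e x = 0"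
proof -
  let ?N = "cls \<kappa> ` {x. act e x = 0}"
  have "right_ideal ?N (E_tilde \<kappa>)"
  proof (rule right_idealI[OF ring_E_tilde])
    show "?N \<subseteq> carrier (E_tilde \<kappa>)"
      using cls_closed by blast
    show "\<zero>\<^bsub>E_tilde \<kappa>\<^esub> \<in> ?N"
      unfolding cls_zero[symmetric] by (rule imageI) simp
    show "y \<oplus>\<^bsub>E_tilde \<kappa>\<^esub> z \<in> ?N" if "y \<in> ?N" "z \<in> ?N" for y z
      using that by (auto simp: cls_add[symmetric] act_add intro!: imageI)
    show "y \<otimes>\<^bsub>E_tilde \<kappa>\<^esub> z \<in> ?N" if "y \<in> ?N" "z \<in> carrier (E_tilde \<kappa>)" for y z
      using that by (auto dest!: cls_surj simp: cls_mult[symmetric] act_mult intro!: imageI)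
  qed
  then have "gen_right_ideal (E_tilde \<kappa>) (cls \<kappa> ` S) \<subseteq> ?N"
    by (rule gen_right_ideal_minimal) (use S in blast)
  then obtain y where "cls \<kappa> x = cls \<kappa> y" "act e y = 0"
    using x by blast
  then show ?thesis
    using I[of "x - y" e] by (simp add: cls_eq_iff act_diff)
qed

lemma plus_act_R_tilde_plus:
  assumes "cls \<kappa> x \<in> R_tilde_plus \<kappa>"
  shows "plus.act (complex_of_real (1 / (2 * \<kappa>))) (1, 0, 0, 0, 0) x = 0"
proof (rule plus.act_gen_right_ideal[OF plus_act_relation_ideal _
      assms[unfolded R_tilde_plus_def Let_def]])
  define h where "h = complex_of_real (1 / (2 * \<kappa>))"
  have h: "complex_of_real (1 / \<kappa>) = 2 * h"
    by (simp add: h_def)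
  show "plus.act (complex_of_real (1 / (2 * \<kappa>))) (1, 0, 0, 0, 0) x = 0"
    if "x \<in> {a0 + a0s - 2, (a0 - 1) * w0, (a0s - 1) * w0, (a0 - 1) * w0s, (a0s - 1) * w0s,
      w0^2 + scalar (complex_of_real (1 / \<kappa>)) * w0,
      w0s^2 - scalar (complex_of_real (1 / \<kappa>)) * w0s}" for x
    using that unfolding h h_def[symmetric]
    by (elim insertE emptyE; hypsubst;
        simp add: plus.act_simps power2_eq_square zero_prod_def)
qed

lemma minus_act_R_tilde_minus:
  assumes "cls \<kappa> x \<in> R_tilde_minus \<kappa>"
  shows "minus.act (complex_of_real (1 / (2 * \<kappa>))) (1, 0, 0, 0, 0) x = 0"
proof (rule minus.act_gen_right_ideal[OF minus_act_relation_ideal _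
      assms[unfolded R_tilde_minus_def Let_def]])
  define h where "h = complex_of_real (1 / (2 * \<kappa>))"
  have h: "complex_of_real (1 / \<kappa>) = 2 * h"
    by (simp add: h_def)
  show "minus.act (complex_of_real (1 / (2 * \<kappa>))) (1, 0, 0, 0, 0) x = 0"
    if "x \<in> {a0^2 + a0 - a0s - 1, a0s^2 + a0s - a0 - 1, (a0 + 1) * w0, (a0s + 1) * w0,
      (a0 + 1) * w0s, (a0s + 1) * w0s,
      w0^2 - scalar (complex_of_real (1 / \<kappa>)) * w0,
      w0s^2 + scalar (complex_of_real (1 / \<kappa>)) * w0s,
      w0 * w0s - scalar (complex_of_real (1 / \<kappa>)) * w0
        - (scalar (complex_of_real (1 / \<kappa>)))^2 * (a0s - 1)}" for x
    using that unfolding h h_def[symmetric]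
    by (elim insertE emptyE; hypsubst;
        simp add: minus.act_simps power2_eq_square zero_prod_def)
qed

text \<open>
  Since \<open>1\<close>, \<open>A\<close>, \<open>V\<close>, \<open>U\<close> and \<open>V U\<close> span the subalgebra modulo the right ideal of the calculus, a larger
  right ideal modulo which they are still independent meets the subalgebra in nothing more.
\<close>

lemma inter_subset_R_4D:
  assumes J: "right_ideal J (E_tilde \<kappa>)" and sub: "R_4D \<kappa> \<subseteq> J"
    and indep: "\<And>c0 c1 c2 c3 c4. cls \<kappa> (scalar c0 + scalar c1 * elem_A + scalar c2 * v_plus
      + scalar c3 * v_minus + scalar c4 * (v_plus * v_minus)) \<in> J \<Longrightarrow>
      c0 = 0 \<and> c1 = 0 \<and> c2 = 0 \<and> c3 = 0 \<and> c4 = 0"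
  shows "J \<inter> carrier (E_kappa \<kappa>) \<subseteq> R_4D \<kappa>"
proof
  fix Y assume "Y \<in> J \<inter> carrier (E_kappa \<kappa>)"
  then obtain y where y: "Y = value_at \<kappa> y" "normal_form \<kappa> y" and "Y \<in> J"
    using E_kappa_normal_form by blast
  then obtain f0 f1 f2 f3 f4 where
    r: "value_at \<kappa> (y - (fscal f0 + fscal f1 * eA + fscal f2 * eV + fscal f3 * eU
        + fscal f4 * (eV * eU))) \<in> R_4D \<kappa>" (is "value_at \<kappa> (y - ?n) \<in> _")
    unfolding normal_form_def by blast
  interpret J: right_ideal_over "{x. value_at \<kappa> x \<in> J}" UNIV
    by (rule value_at_right_ideal[OF J])
  have n: "?n = family (\<lambda>\<kappa>. scalar (f0 \<kappa>) + scalar (f1 \<kappa>) * elem_A + scalar (f2 \<kappa>) * v_plus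
      + scalar (f3 \<kappa>) * v_minus + scalar (f4 \<kappa>) * (v_plus * v_minus))"
    by (simp add: family_simps eA_def eV_def eU_def)
  have "value_at \<kappa> (y - (y - ?n)) \<in> J"
    using J.diff[of y "y - ?n"] r sub y \<open>Y \<in> J\<close> by blast
  then have "value_at \<kappa> ?n \<in> J"
    unfolding diff_diff_eq2 add_diff_cancel_left' .
  then have "f0 \<kappa> = 0 \<and> f1 \<kappa> = 0 \<and> f2 \<kappa> = 0 \<and> f3 \<kappa> = 0 \<and> f4 \<kappa> = 0"
    unfolding n value_at_family by (rule indep)
  then have "value_at \<kappa> ?n = value_at \<kappa> (family (\<lambda>_. 0))"
    unfolding n value_at_family by (simp add: scalar_def)
  then have "value_at \<kappa> (y - ?n + ?n) = value_at \<kappa> (y - ?n + 0)"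
    by (simp only: value_at_add family_zero)
  then show "Y \<in> R_4D \<kappa>"
    using r y by simp
qed

theorem theorem5:
  fixes \<kappa> :: real
  assumes "\<kappa> \<noteq> 0"
  shows "R_tilde_plus \<kappa> \<inter> carrier (E_kappa \<kappa>) = R_tilde_minus \<kappa> \<inter> carrier (E_kappa \<kappa>) \<and>
         R_tilde_minus \<kappa> \<inter> carrier (E_kappa \<kappa>) = R_4D \<kappa>"
proof -
  define h where "h = complex_of_real (1 / (2 * \<kappa>))"
  have h: "h \<noteq> 0"
    using assms by (simp add: h_def)
  have "R_tilde_plus \<kappa> \<inter> carrier (E_kappa \<kappa>) \<subseteq> R_4D \<kappa>"
  proof (rule inter_subset_R_4D[OF right_ideal_R_tilde(1)])
    show "R_4D \<kappa> \<subseteq> R_tilde_plus \<kappa>"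
      using R_4D_subset_plus by blast
    show "c0 = 0 \<and> c1 = 0 \<and> c2 = 0 \<and> c3 = 0 \<and> c4 = 0"
      if "cls \<kappa> (scalar c0 + scalar c1 * elem_A + scalar c2 * v_plus
        + scalar c3 * v_minus + scalar c4 * (v_plus * v_minus)) \<in> R_tilde_plus \<kappa>"
      for c0 c1 c2 c3 c4
      using plus_act_R_tilde_plus[OF that, folded h_def]
      by (auto simp: plus.act_simps power2_eq_square zero_prod_def elem_A_def v_plus_def
          v_minus_def)
  qed
  then have "R_tilde_plus \<kappa> \<inter> carrier (E_kappa \<kappa>) = R_4D \<kappa>"
    using R_4D_subset_plus by blast
  moreover have "R_tilde_minus \<kappa> \<inter> carrier (E_kappa \<kappa>) \<subseteq> R_4D \<kappa>"
  proof (rule inter_subset_R_4D[OF right_ideal_R_tilde(2)])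
    show "R_4D \<kappa> \<subseteq> R_tilde_minus \<kappa>"
      using R_4D_subset_minus by blast
    show "c0 = 0 \<and> c1 = 0 \<and> c2 = 0 \<and> c3 = 0 \<and> c4 = 0"
      if "cls \<kappa> (scalar c0 + scalar c1 * elem_A + scalar c2 * v_plus
        + scalar c3 * v_minus + scalar c4 * (v_plus * v_minus)) \<in> R_tilde_minus \<kappa>"
      for c0 c1 c2 c3 c4
      \<comment> \<open>The image of \<open>V U\<close> has the coordinate \<open>4 h\<^sup>2\<close> at \<open>g\<close>, the images of the other four have \<open>0\<close>
        there: independence depends on \<open>h \<noteq> 0\<close>.\<close>
      using minus_act_R_tilde_minus[OF that, folded h_def] h
      by (auto simp: minus.act_simps power2_eq_square zero_prod_def elem_A_def v_plus_def
          v_minus_def)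
  qed
  then have "R_tilde_minus \<kappa> \<inter> carrier (E_kappa \<kappa>) = R_4D \<kappa>"
    using R_4D_subset_minus by blast
  ultimately show ?thesis by simp
qed

end
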